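(* Let $\delta\ge 2$ be an integer and let $G$ be a connected graph of even order $n$ with minimum degree $\delta$, where $n\ge \max\{8\delta-7,\ \tfrac13\delta^2+3\}$. If $$\rho_{\mathcal D}(G)\ \le\ \rho_{\mathcal D}\big(K_\delta\vee(K_{n-2\delta+1}\cup(\delta-1)K_1)\big),$$ then $G$ contains an even factor, unless $G\cong K_\delta\vee(K_{n-2\delta+1}\cup(\delta-1)K_1)$.
   Context: All graphs are finite, simple and undirected. An even factor of a graph $G$ is a spanning subgraph $F$ of $G$ such that $d_F(v)$ is a nonzero even number for every vertex $v\in V(G)$. For a connected graph $G$ on vertices $v_1,\dots,v_n$, the distance matrix $\mathcal D(G)$ is the $n\times n$ matrix whose $(i,j)$-entry is the distance (length of a shortest path) between $v_i$ and $v_j$; $\rho_{\mathcal D}(G)$ denotes its largest eigenvalue (the distance spectral radius). $K_m$ is the complete graph on $m$ vertices, $G_1\cup G_2$ is the disjoint union, $tK_1$ is the edgeless graph on $t$ vertices, and $G_1\vee G_2$ (join) is obtained from $G_1\cup G_2$ by adding all edges between $V(G_1)$ and $V(G_2)$. *)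

theory Defs
  imports Complex_Main
begin

definition simple_graph :: "'a set \<Rightarrow> ('a \<Rightarrow> 'a \<Rightarrow> bool) \<Rightarrow> bool" where
  "simple_graph V E \<longleftrightarrow> finite V \<and> (\<forall>u v. E u v \<longrightarrow> E v u) \<and> (\<forall>v. \<not> E v v)
     \<and> (\<forall>u v. E u v \<longrightarrow> u \<in> V \<and> v \<in> V)"

definition degree :: "'a set \<Rightarrow> ('a \<Rightarrow> 'a \<Rightarrow> bool) \<Rightarrow> 'a \<Rightarrow> nat" where
  "degree V E v = card {w \<in> V. E v w}"

definition min_degree :: "'a set \<Rightarrow> ('a \<Rightarrow> 'a \<Rightarrow> bool) \<Rightarrow> nat" where
  "min_degree V E = Min (degree V E ` V)"

definition walk_of_length :: "'a set \<Rightarrow> ('a \<Rightarrow> 'a \<Rightarrow> bool) \<Rightarrow> 'a \<Rightarrow> 'a \<Rightarrow> nat \<Rightarrow> bool" where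
  "walk_of_length V E u v k \<longleftrightarrow> (\<exists>xs. length xs = Suc k \<and> hd xs = u \<and> last xs = v
      \<and> set xs \<subseteq> V \<and> (\<forall>i < k. E (xs ! i) (xs ! Suc i)))"

definition connected_graph :: "'a set \<Rightarrow> ('a \<Rightarrow> 'a \<Rightarrow> bool) \<Rightarrow> bool" where
  "connected_graph V E \<longleftrightarrow> V \<noteq> {} \<and> (\<forall>u\<in>V. \<forall>v\<in>V. \<exists>k. walk_of_length V E u v k)"

definition gdist :: "'a set \<Rightarrow> ('a \<Rightarrow> 'a \<Rightarrow> bool) \<Rightarrow> 'a \<Rightarrow> 'a \<Rightarrow> nat" where
  "gdist V E u v = (LEAST k. walk_of_length V E u v k)"

definition dist_eigenvalue :: "'a set \<Rightarrow> ('a \<Rightarrow> 'a \<Rightarrow> bool) \<Rightarrow> real \<Rightarrow> bool" where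
  "dist_eigenvalue V E mu \<longleftrightarrow> (\<exists>x :: 'a \<Rightarrow> real. (\<exists>v\<in>V. x v \<noteq> 0) \<and>
      (\<forall>u\<in>V. (\<Sum>w\<in>V. real (gdist V E u w) * x w) = mu * x u))"

definition dist_spectral_radius :: "'a set \<Rightarrow> ('a \<Rightarrow> 'a \<Rightarrow> bool) \<Rightarrow> real" where
  "dist_spectral_radius V E = Max {mu. dist_eigenvalue V E mu}"

definition has_even_factor :: "'a set \<Rightarrow> ('a \<Rightarrow> 'a \<Rightarrow> bool) \<Rightarrow> bool" where
  "has_even_factor V E \<longleftrightarrow> (\<exists>F. (\<forall>u v. F u v \<longrightarrow> E u v) \<and> (\<forall>u v. F u v \<longrightarrow> F v u)
      \<and> (\<forall>v\<in>V. degree V F v \<noteq> 0 \<and> even (degree V F v)))"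

definition graph_iso :: "'a set \<Rightarrow> ('a \<Rightarrow> 'a \<Rightarrow> bool) \<Rightarrow> 'b set \<Rightarrow> ('b \<Rightarrow> 'b \<Rightarrow> bool) \<Rightarrow> bool" where
  "graph_iso V E W H \<longleftrightarrow> (\<exists>f. bij_betw f V W \<and> (\<forall>u\<in>V. \<forall>v\<in>V. E u v \<longleftrightarrow> H (f u) (f v)))"

text \<open>K_d \<or> (K_{n-2d+1} \<union> (d-1)K_1) on vertex set {0..<n}:
  vertices 0..<d form K_d, vertices d..<n-d+1 form K_{n-2d+1},
  vertices n-d+1..<n are the d-1 isolated vertices of the second part.\<close>
definition ext_vertices :: "nat \<Rightarrow> nat set" where
  "ext_vertices n = {0..<n}"

definition ext_edge :: "nat \<Rightarrow> nat \<Rightarrow> nat \<Rightarrow> nat \<Rightarrow> bool" where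
  "ext_edge n d u v \<longleftrightarrow> u \<noteq> v \<and> u < n \<and> v < n \<and>
     (u < d \<or> v < d \<or> (d \<le> u \<and> u < n - d + 1 \<and> d \<le> v \<and> v < n - d + 1))"

end

theory Submission
  imports Defs "HOL-Analysis.Function_Topology"
begin

text \<open>Put k = \<delta> - 1. The distance spectral radius of G is at least its average transmission, and
  that of the extremal graph is bounded by a test vector constant on its three vertex classes;
  together these leave G at most 3k(n - 2k - 1)/2 non-edges. Let F be an even subgraph of G covering
  as many vertices as possible and, subject to that, having as many edges as possible. Then the
  complement of F is a forest. If v is uncovered, all edges at v lie in this forest. Since the forest
  is sparse and G is dense, the vertices of F-degree at least 4 span a component K with at least n/2
  vertices. Taking the symmetric difference of F with a suitable cycle through v would cover v
  without uncovering anything; hence at most one branch of the forest at v is adjacent to K and no two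
  branches are adjacent. The k remaining branches force so many non-edges between K and its
  complement that the bound is violated.\<close>

section \<open>Eigenvalues of symmetric forms on a finite set\<close>

text \<open>The factor 3 does not count non-edges of the extremal graph; it reflects its Perron
  vector. The k independent vertices have transmission near 2n and all others near n when n is
  large, so their entries are about twice the rest, and a row of the big clique then gives a radius
  near n - 1 + 3k. Hence G may miss roughly half as many edges again as the extremal graph, and no
  structural comparison of the two is made: a cut with many missing edges has to be extracted from
  the failure of F alone.

  What obstructs rerouting F is a vertex of F-degree 2, since a cycle using both of its F-edges
  uncovers it. Parity leaves no degree between 2 and 4, so such vertices are cleanly separated from
  those that a cycle may cross freely.

  The minimum degree is what makes the cut expensive: it forces at least 2k + 1 vertices outside K.
  At exactly 2k + 1, about 2k|K| pairs across the cut are missing, against an allowance of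
  3k|K|/2.\<close>

definition eigenvalue_on :: "'a set \<Rightarrow> ('a \<Rightarrow> 'a \<Rightarrow> real) \<Rightarrow> real \<Rightarrow> bool" where
  "eigenvalue_on V D mu \<longleftrightarrow> (\<exists>x. (\<exists>v\<in>V. x v \<noteq> 0) \<and> (\<forall>u\<in>V. (\<Sum>w\<in>V. D u w * x w) = mu * x u))"

lemma symmetric_form_sum_swap:
  fixes D :: "'a \<Rightarrow> 'a \<Rightarrow> real"
  assumes "\<And>u w. u \<in> V \<Longrightarrow> w \<in> V \<Longrightarrow> D u w = D w u"
  shows "(\<Sum>u\<in>V. x u * (\<Sum>w\<in>V. D u w * y w)) = (\<Sum>u\<in>V. y u * (\<Sum>w\<in>V. D u w * x w))"
proof -
  have "(\<Sum>u\<in>V. x u * (\<Sum>w\<in>V. D u w * y w)) = (\<Sum>u\<in>V. \<Sum>w\<in>V. x u * (D u w * y w))"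
    by (simp add: sum_distrib_left)
  also have "\<dots> = (\<Sum>w\<in>V. \<Sum>u\<in>V. x u * (D u w * y w))" by (rule sum.swap)
  also have "\<dots> = (\<Sum>w\<in>V. \<Sum>u\<in>V. y w * (D w u * x u))"
    by (intro sum.cong refl) (use assms in \<open>simp add: mult_ac\<close>)
  finally show ?thesis by (simp add: sum_distrib_left)
qed

text \<open>The first-order condition at a maximum: for small t of either sign the linear term would
  beat the quadratic one.\<close>

lemma linear_coefficient_zero:
  fixes a b :: real
  assumes "\<And>t. 2 * t * a \<le> t\<^sup>2 * b"
  shows "a = 0"
proof (rule ccontr)
  assume "a \<noteq> 0"
  define m where "m = \<bar>b\<bar> + 1"
  have m: "m > 0" "b \<le> m" "b < 2 * m" unfolding m_def by auto
  have "2 * (a / m) * a \<le> (a / m)\<^sup>2 * b" by (rule assms)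
  hence "2 * a\<^sup>2 / m \<le> a\<^sup>2 * b / m\<^sup>2" by (simp add: power2_eq_square)
  hence "2 * a\<^sup>2 * m \<le> a\<^sup>2 * b" using m by (simp add: field_simps power2_eq_square)
  hence "a\<^sup>2 * (2 * m) \<le> a\<^sup>2 * b" by (simp add: mult_ac)
  thus False using m \<open>a \<noteq> 0\<close> by (simp add: mult_le_cancel_left)
qed

text \<open>The vectors are functions on the whole type, which may be infinite. Vanishing off
  \<open>V\<close> makes the sphere a closed subset of a product of intervals, degenerate outside
  \<open>V\<close>, and Tychonoff applies.\<close>

lemma unit_sphere_compact:
  fixes V :: "'a set"
  assumes "finite V"
  shows "compact {x :: 'a \<Rightarrow> real. (\<forall>i. i \<notin> V \<longrightarrow> x i = 0) \<and> (\<Sum>i\<in>V. (x i)\<^sup>2) = 1}" (is "compact ?S")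
proof -
  define B where "B = PiE UNIV (\<lambda>i. if i \<in> V then {-1..1} else {0::real})"
  have "compactin (product_topology (\<lambda>i. euclidean) UNIV) B"
    unfolding B_def compactin_PiE by auto
  hence cB: "compact B"
    by (simp add: euclidean_product_topology)
  have cl: "closed {x :: 'a \<Rightarrow> real. (\<Sum>i\<in>V. (x i)\<^sup>2) = 1}"
    by (intro closed_Collect_eq continuous_intros continuous_on_product_coordinates)
  have "?S = B \<inter> {x. (\<Sum>i\<in>V. (x i)\<^sup>2) = 1}"
  proof (intro set_eqI iffI)
    fix x assume x: "x \<in> ?S"
    have "x i \<in> {-1..1}" if "i \<in> V" for i
    proof -
      have "(x i)\<^sup>2 \<le> (\<Sum>i\<in>V. (x i)\<^sup>2)" by (rule member_le_sum) (use that assms in auto)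
      hence "\<bar>x i\<bar> \<le> 1" using x abs_square_le_1 by auto
      thus ?thesis by auto
    qed
    thus "x \<in> B \<inter> {x. (\<Sum>i\<in>V. (x i)\<^sup>2) = 1}" using x unfolding B_def by auto
  next
    fix x assume "x \<in> B \<inter> {x. (\<Sum>i\<in>V. (x i)\<^sup>2) = 1}"
    thus "x \<in> ?S" unfolding B_def by (auto simp: PiE_def Pi_def split: if_splits)
  qed
  thus ?thesis using compact_Int_closed[OF cB cl] by simp
qed

text \<open>A maximiser of the quadratic form on the unit sphere is an eigenvector, because its
  first variation vanishes in every coordinate direction. The domination of the form is what turns a
  test vector into a lower bound for the spectral radius.\<close>

lemma symmetric_eigenvalue_dominating_form:
  fixes D :: "'a \<Rightarrow> 'a \<Rightarrow> real"
  assumes fin: "finite V" and ne: "V \<noteq> {}"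
    and sym: "\<And>u w. u \<in> V \<Longrightarrow> w \<in> V \<Longrightarrow> D u w = D w u"
  obtains l where "eigenvalue_on V D l"
    and "\<And>x. (\<Sum>u\<in>V. x u * (\<Sum>w\<in>V. D u w * x w)) \<le> l * (\<Sum>u\<in>V. (x u)\<^sup>2)"
proof -
  define S where "S = {x :: 'a \<Rightarrow> real. (\<forall>i. i \<notin> V \<longrightarrow> x i = 0) \<and> (\<Sum>i\<in>V. (x i)\<^sup>2) = 1}"
  define Q where "Q x = (\<Sum>u\<in>V. x u * (\<Sum>w\<in>V. D u w * x w))" for x :: "'a \<Rightarrow> real"
  obtain v where v: "v \<in> V" using ne by auto
  have "(\<lambda>i. if i = v then 1 else 0) \<in> S"
    using v fin by (auto simp: S_def if_distrib[where f="\<lambda>x. x\<^sup>2"] cong: if_cong)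
  hence "S \<noteq> {}" by auto
  moreover have "continuous_on S Q" unfolding Q_def
    by (rule continuous_on_subset[OF _ subset_UNIV])
       (intro continuous_intros continuous_on_product_coordinates)
  moreover have "compact S" unfolding S_def by (rule unit_sphere_compact[OF fin])
  ultimately obtain z where z: "z \<in> S" and mx: "\<And>y. y \<in> S \<Longrightarrow> Q y \<le> Q z"
    using continuous_attains_sup by metis
  define l where "l = Q z"
  have dom: "Q x \<le> l * (\<Sum>u\<in>V. (x u)\<^sup>2)" for x
  proof (cases "(\<Sum>u\<in>V. (x u)\<^sup>2) = 0")
    case True
    hence "\<And>u. u \<in> V \<Longrightarrow> x u = 0" using fin by (simp add: sum_nonneg_eq_0_iff)
    hence "Q x = 0" unfolding Q_def by simp
    thus ?thesis using True by simp
  next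
    case False
    define r where "r = (\<Sum>u\<in>V. (x u)\<^sup>2)"
    have r: "r > 0" using False sum_nonneg[of V "\<lambda>u. (x u)\<^sup>2"] unfolding r_def by simp
    define y where "y i = (if i \<in> V then x i / sqrt r else 0)" for i
    have "(\<Sum>i\<in>V. (y i)\<^sup>2) = r / r"
      using r unfolding y_def r_def[symmetric]
      by (simp add: power_divide sum_divide_distrib[symmetric] r_def)
    hence "y \<in> S" using r by (simp add: S_def y_def)
    hence "Q y \<le> l" using mx l_def by simp
    moreover have "Q y = Q x / r"
    proof -
      have "Q y = (\<Sum>u\<in>V. (x u * (\<Sum>w\<in>V. D u w * x w)) / r)" unfolding Q_def
      proof (intro sum.cong refl)
        fix u assume u: "u \<in> V"
        have "(\<Sum>w\<in>V. D u w * y w) = (\<Sum>w\<in>V. D u w * x w) / sqrt r"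
          unfolding sum_divide_distrib by (intro sum.cong) (auto simp: y_def)
        thus "y u * (\<Sum>w\<in>V. D u w * y w) = (x u * (\<Sum>w\<in>V. D u w * x w)) / r"
          using u r by (simp add: y_def)
      qed
      thus ?thesis by (simp add: Q_def sum_divide_distrib)
    qed
    ultimately show ?thesis using r by (simp add: r_def[symmetric] field_simps)
  qed
  have zn: "(\<Sum>i\<in>V. (z i)\<^sup>2) = 1" using z by (simp add: S_def)
  have "(\<Sum>w\<in>V. D u w * z w) = l * z u" if u: "u \<in> V" for u
  proof -
    \<comment> \<open>\<open>h\<close> is the coordinate vector at \<open>u\<close>, and
      \<open>a\<close> below is the \<open>u\<close>-th entry of Dz - lz, which is to
      vanish.\<close>
    define h where "h i = (if i = u then 1 else (0::real))" for i
    have hs: "(\<Sum>i\<in>V. h i * f i) = f u" "(\<Sum>i\<in>V. f i * h i) = f u" for f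
      using u fin by (simp_all add: h_def if_distrib[where f="\<lambda>x. x * _"] if_distrib[where f="\<lambda>x. _ * x"] cong: if_cong)
    define a where "a = (\<Sum>w\<in>V. D u w * z w) - l * z u"
    have "2 * t * a \<le> t\<^sup>2 * (l - D u u)" for t
    proof -
      have "Q (\<lambda>i. z i + t * h i) = Q z + t * (\<Sum>i\<in>V. z i * (\<Sum>w\<in>V. D i w * h w))
           + t * (\<Sum>i\<in>V. h i * (\<Sum>w\<in>V. D i w * z w)) + t\<^sup>2 * (\<Sum>i\<in>V. h i * (\<Sum>w\<in>V. D i w * h w))"
        unfolding Q_def by (simp add: algebra_simps sum.distrib sum_distrib_left power2_eq_square)
      also have "(\<Sum>i\<in>V. z i * (\<Sum>w\<in>V. D i w * h w)) = (\<Sum>i\<in>V. h i * (\<Sum>w\<in>V. D i w * z w))"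
        by (rule symmetric_form_sum_swap[OF sym])
      finally have q: "Q (\<lambda>i. z i + t * h i) = l + 2 * t * (\<Sum>w\<in>V. D u w * z w) + t\<^sup>2 * D u u"
        by (simp add: hs l_def)
      have "(\<Sum>i\<in>V. (z i + t * h i)\<^sup>2)
          = (\<Sum>i\<in>V. (z i)\<^sup>2) + 2 * t * (\<Sum>i\<in>V. h i * z i) + t\<^sup>2 * (\<Sum>i\<in>V. h i * h i)"
        by (simp add: algebra_simps sum.distrib sum_distrib_left power2_eq_square)
      also have "\<dots> = 1 + 2 * t * z u + t\<^sup>2"
        unfolding hs zn by (simp add: h_def)
      finally have "l + 2 * t * (\<Sum>w\<in>V. D u w * z w) + t\<^sup>2 * D u u \<le> l * (1 + 2 * t * z u + t\<^sup>2)"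
        using dom[of "\<lambda>i. z i + t * h i"] q by simp
      thus ?thesis by (simp add: a_def algebra_simps)
    qed
    hence "a = 0" by (rule linear_coefficient_zero)
    thus ?thesis by (simp add: a_def)
  qed
  moreover have "\<exists>v\<in>V. z v \<noteq> 0"
  proof (rule ccontr)
    assume "\<not> (\<exists>v\<in>V. z v \<noteq> 0)"
    hence "(\<Sum>i\<in>V. (z i)\<^sup>2) = 0" by simp
    thus False using zn by simp
  qed
  ultimately have "eigenvalue_on V D l" unfolding eigenvalue_on_def by blast
  thus ?thesis using that dom unfolding Q_def by blast
qed

text \<open>Needed to make the \<open>Max\<close> in \<open>dist_spectral_radius\<close> meaningful.
  Eigenvectors of distinct eigenvalues are orthogonal, so \<open>M\<close> gives an orthonormal
  family; Bessel's inequality for each coordinate vector, summed over \<open>V\<close>, bounds its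
  size by \<open>card V\<close>.\<close>

lemma symmetric_eigenvalues_finite:
  fixes D :: "'a \<Rightarrow> 'a \<Rightarrow> real"
  assumes fin: "finite V" and sym: "\<And>u w. u \<in> V \<Longrightarrow> w \<in> V \<Longrightarrow> D u w = D w u"
  shows "finite {mu. eigenvalue_on V D mu}"
proof -
  have "card M \<le> card V" if M: "M \<subseteq> {mu. eigenvalue_on V D mu}" and fM: "finite M" for M
  proof -
    have "\<exists>e. (\<Sum>u\<in>V. (e u)\<^sup>2) = 1 \<and> (\<forall>u\<in>V. (\<Sum>w\<in>V. D u w * e w) = mu * e u)" if "mu \<in> M" for mu
    proof -
      obtain x where x: "\<exists>v\<in>V. x v \<noteq> 0" "\<forall>u\<in>V. (\<Sum>w\<in>V. D u w * x w) = mu * x u"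
        using M \<open>mu \<in> M\<close> unfolding eigenvalue_on_def by blast
      define r where "r = (\<Sum>u\<in>V. (x u)\<^sup>2)"
      have r: "r > 0" unfolding r_def using x(1) fin
        by (meson sum_pos2 zero_le_power2 zero_less_power2)
      have "(\<Sum>u\<in>V. (x u / sqrt r)\<^sup>2) = r / r"
        using r by (simp add: power_divide sum_divide_distrib[symmetric] r_def[symmetric])
      moreover have "(\<Sum>w\<in>V. D u w * (x w / sqrt r)) = mu * (x u / sqrt r)" if "u \<in> V" for u
        using x(2) that by (simp add: sum_divide_distrib[symmetric])
      ultimately show ?thesis using r by (intro exI[of _ "\<lambda>u. x u / sqrt r"]) auto
    qed
    then obtain e where en: "\<And>mu. mu \<in> M \<Longrightarrow> (\<Sum>u\<in>V. (e mu u)\<^sup>2) = 1"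
      and ee: "\<And>mu u. mu \<in> M \<Longrightarrow> u \<in> V \<Longrightarrow> (\<Sum>w\<in>V. D u w * e mu w) = mu * e mu u"
      by metis
    have orth: "(\<Sum>u\<in>V. e mu u * e nu u) = (if mu = nu then 1 else 0)" if "mu \<in> M" "nu \<in> M" for mu nu
    proof (cases "mu = nu")
      case True
      thus ?thesis using en[OF that(1)] by (simp add: power2_eq_square)
    next
      case False
      have "mu * (\<Sum>u\<in>V. e mu u * e nu u) = (\<Sum>u\<in>V. e nu u * (\<Sum>w\<in>V. D u w * e mu w))"
        using ee[OF that(1)] by (simp add: sum_distrib_left mult_ac)
      also have "\<dots> = (\<Sum>u\<in>V. e mu u * (\<Sum>w\<in>V. D u w * e nu w))"
        by (rule symmetric_form_sum_swap[OF sym])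
      also have "\<dots> = nu * (\<Sum>u\<in>V. e mu u * e nu u)"
        using ee[OF that(2)] by (simp add: sum_distrib_left mult_ac)
      finally show ?thesis using False by simp
    qed
    have bessel: "(\<Sum>mu\<in>M. (e mu v)\<^sup>2) \<le> 1" if v: "v \<in> V" for v
    proof -
      \<comment> \<open>\<open>p\<close> is the orthogonal projection of the coordinate vector
        \<open>h\<close> at \<open>v\<close> onto the span of the family, since
        \<open>e mu v\<close> is the inner product of \<open>h\<close> and
        \<open>e mu\<close>.\<close>
      define h where "h i = (if i = v then 1 else (0::real))" for i
      define p where "p i = (\<Sum>mu\<in>M. e mu v * e mu i)" for i
      have hs: "(\<Sum>i\<in>V. h i * f i) = f v" for f
        using v fin by (simp add: h_def if_distrib[where f="\<lambda>x. x * _"] cong: if_cong)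
      have pp: "(\<Sum>i\<in>V. p i * p i) = p v"
      proof -
        have "(\<Sum>i\<in>V. p i * p i) = (\<Sum>i\<in>V. \<Sum>mu\<in>M. \<Sum>nu\<in>M. e mu v * e nu v * (e mu i * e nu i))"
          unfolding p_def sum_product by (intro sum.cong refl) (simp add: mult_ac)
        also have "\<dots> = (\<Sum>mu\<in>M. \<Sum>i\<in>V. \<Sum>nu\<in>M. e mu v * e nu v * (e mu i * e nu i))"
          by (rule sum.swap)
        also have "\<dots> = (\<Sum>mu\<in>M. \<Sum>nu\<in>M. \<Sum>i\<in>V. e mu v * e nu v * (e mu i * e nu i))"
          by (intro sum.cong refl sum.swap)
        also have "\<dots> = (\<Sum>mu\<in>M. \<Sum>nu\<in>M. e mu v * e nu v * (if mu = nu then 1 else 0))"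
          by (intro sum.cong refl) (simp add: sum_distrib_left[symmetric] orth)
        also have "\<dots> = (\<Sum>mu\<in>M. e mu v * e mu v)"
          using fM by (simp add: if_distrib[where f="\<lambda>x. _ * x"] cong: if_cong)
        finally show ?thesis by (simp add: p_def)
      qed
      have "0 \<le> (\<Sum>i\<in>V. (h i - p i)\<^sup>2)" by (simp add: sum_nonneg)
      also have "\<dots> = (\<Sum>i\<in>V. h i * h i) - 2 * (\<Sum>i\<in>V. h i * p i) + (\<Sum>i\<in>V. p i * p i)"
        by (simp add: power2_eq_square algebra_simps sum.distrib sum_subtractf sum_distrib_left)
      also have "\<dots> = 1 - p v" unfolding hs pp by (simp add: h_def)
      finally show ?thesis by (simp add: p_def power2_eq_square)
    qed
    have "real (card M) = (\<Sum>mu\<in>M. \<Sum>v\<in>V. (e mu v)\<^sup>2)" using en by simp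
    also have "\<dots> = (\<Sum>v\<in>V. \<Sum>mu\<in>M. (e mu v)\<^sup>2)" by (rule sum.swap)
    also have "\<dots> \<le> (\<Sum>v\<in>V. 1)" by (rule sum_mono) (rule bessel)
    finally show ?thesis by simp
  qed
  thus ?thesis using finite_if_finite_subsets_card_bdd by blast
qed

text \<open>The Collatz-Wielandt bound: read the eigenvalue equation in the row \<open>u\<close>
  where the ratio of |x| to \<open>y\<close> is largest.\<close>

lemma eigenvalue_le_of_positive_supersolution:
  fixes D :: "'a \<Rightarrow> 'a \<Rightarrow> real"
  assumes fin: "finite V" and nn: "\<And>u w. u \<in> V \<Longrightarrow> w \<in> V \<Longrightarrow> D u w \<ge> 0"
    and y: "\<And>u. u \<in> V \<Longrightarrow> y u > 0"
    and sup: "\<And>u. u \<in> V \<Longrightarrow> (\<Sum>w\<in>V. D u w * y w) \<le> l * y u"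
    and ev: "eigenvalue_on V D mu"
  shows "mu \<le> l"
proof -
  obtain x where x: "\<exists>v\<in>V. x v \<noteq> 0" "\<And>u. u \<in> V \<Longrightarrow> (\<Sum>w\<in>V. D u w * x w) = mu * x u"
    using ev unfolding eigenvalue_on_def by blast
  have "V \<noteq> {}" using x(1) by auto
  then obtain u where u: "u \<in> V" and "\<bar>x u\<bar> / y u = Max ((\<lambda>w. \<bar>x w\<bar> / y w) ` V)"
    using Max_in[of "(\<lambda>w. \<bar>x w\<bar> / y w) ` V"] fin by fastforce
  hence umax: "\<bar>x w\<bar> / y w \<le> \<bar>x u\<bar> / y u" if "w \<in> V" for w
    using that fin by simp
  define r where "r = \<bar>x u\<bar> / y u"
  have xr: "\<bar>x w\<bar> \<le> r * y w" if "w \<in> V" for w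
    using umax[OF that] y[OF that] by (simp add: r_def[symmetric] field_simps)
  have r: "r > 0"
  proof -
    obtain v where v: "v \<in> V" "x v \<noteq> 0" using x(1) by auto
    hence "\<bar>x v\<bar> / y v > 0" using y by simp
    thus ?thesis using umax[OF v(1)] by (simp add: r_def)
  qed
  have "\<bar>mu\<bar> * \<bar>x u\<bar> = \<bar>\<Sum>w\<in>V. D u w * x w\<bar>" using x(2)[OF u] by (simp add: abs_mult)
  also have "\<dots> \<le> (\<Sum>w\<in>V. \<bar>D u w * x w\<bar>)" by (rule sum_abs)
  also have "\<dots> \<le> (\<Sum>w\<in>V. r * (D u w * y w))"
  proof (rule sum_mono)
    fix w assume w: "w \<in> V"
    have "D u w * \<bar>x w\<bar> \<le> D u w * (r * y w)" using xr[OF w] nn[OF u w] by (rule mult_left_mono)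
    thus "\<bar>D u w * x w\<bar> \<le> r * (D u w * y w)" using nn[OF u w] by (simp add: abs_mult mult_ac)
  qed
  also have "\<dots> \<le> r * (l * y u)"
    unfolding sum_distrib_left[symmetric] using sup[OF u] r by (simp add: mult_left_mono)
  also have "\<dots> = l * \<bar>x u\<bar>" using y[OF u] by (simp add: r_def)
  finally have "\<bar>mu\<bar> * \<bar>x u\<bar> \<le> l * \<bar>x u\<bar>" .
  moreover have "\<bar>x u\<bar> > 0" using r y[OF u] by (simp add: r_def zero_less_divide_iff)
  ultimately show ?thesis by (simp add: mult_le_cancel_right)
qed

section \<open>Distance spectral radii\<close>

lemma dist_eigenvalue_iff: "dist_eigenvalue V E mu \<longleftrightarrow> eigenvalue_on V (\<lambda>u w. real (gdist V E u w)) mu"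
  by (simp add: dist_eigenvalue_def eigenvalue_on_def)

lemma walk_of_length_rev:
  assumes "\<And>u v. E u v \<Longrightarrow> E v u" and "walk_of_length V E u v k"
  shows "walk_of_length V E v u k"
proof -
  obtain xs where xs: "length xs = Suc k" "hd xs = u" "last xs = v" "set xs \<subseteq> V"
    and e: "\<And>i. i < k \<Longrightarrow> E (xs ! i) (xs ! Suc i)"
    using assms(2) unfolding walk_of_length_def by blast
  have "E (rev xs ! i) (rev xs ! Suc i)" if "i < k" for i
  proof -
    have "E (xs ! (k - Suc i)) (xs ! Suc (k - Suc i))" using that by (intro e) auto
    thus ?thesis using that xs(1) assms(1) by (simp add: rev_nth Suc_diff_Suc)
  qed
  moreover have "xs \<noteq> []" using xs(1) by auto
  ultimately show ?thesis unfolding walk_of_length_def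
    by (intro exI[of _ "rev xs"]) (use xs in \<open>simp add: hd_rev last_rev\<close>)
qed

lemma gdist_commute:
  assumes "\<And>u v. E u v \<Longrightarrow> E v u"
  shows "gdist V E u v = gdist V E v u"
proof -
  have "walk_of_length V E u v k \<longleftrightarrow> walk_of_length V E v u k" for k
    using walk_of_length_rev[of E V u v k] walk_of_length_rev[of E V v u k] assms by blast
  hence "walk_of_length V E u v = walk_of_length V E v u" by (rule ext)
  thus ?thesis unfolding gdist_def by simp
qed

lemma gdist_le: "walk_of_length V E u v k \<Longrightarrow> gdist V E u v \<le> k"
  unfolding gdist_def by (rule Least_le)

lemma gdist_lower:
  assumes "connected_graph V E" "u \<in> V" "v \<in> V" "u \<noteq> v"
  shows "gdist V E u v \<ge> (if E u v then 1 else 2)"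
proof -
  have "\<exists>k. walk_of_length V E u v k" using assms unfolding connected_graph_def by blast
  hence w: "walk_of_length V E u v (gdist V E u v)" unfolding gdist_def by (rule LeastI_ex)
  then obtain xs where xs: "length xs = Suc (gdist V E u v)" "hd xs = u" "last xs = v"
    and e: "\<And>i. i < gdist V E u v \<Longrightarrow> E (xs ! i) (xs ! Suc i)"
    unfolding walk_of_length_def by blast
  have "gdist V E u v \<noteq> 0"
  proof
    assume "gdist V E u v = 0"
    then obtain a where "xs = [a]" using xs(1) by (auto simp: length_Suc_conv)
    thus False using xs assms(4) by simp
  qed
  moreover have "E u v" if "gdist V E u v = 1"
  proof -
    from that obtain a b where "xs = [a, b]" using xs(1) by (auto simp: length_Suc_conv)
    thus ?thesis using xs e[of 0] that by simp
  qed
  ultimately show ?thesis by force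
qed

text \<open>The test vector is constant 1. Each non-neighbour is at distance at least 2 and so
  contributes one extra unit to a row sum; the second summand is twice the number of
  non-edges.\<close>

lemma dist_spectral_radius_ge_average:
  assumes G: "simple_graph V E" "connected_graph V E" and n: "card V = n"
  shows "real n * real (n - 1) + real (\<Sum>v\<in>V. n - 1 - degree V E v) \<le> real n * dist_spectral_radius V E"
proof -
  have fin: "finite V" and sym: "\<And>u v. E u v \<Longrightarrow> E v u" and irr: "\<And>v. \<not> E v v"
    using G(1) unfolding simple_graph_def by blast+
  have ne: "V \<noteq> {}" using G(2) unfolding connected_graph_def by blast
  define D where "D u w = real (gdist V E u w)" for u w
  have Dsym: "D u w = D w u" for u w unfolding D_def using gdist_commute[of E V u w, OF sym] by simp
  obtain l where l: "eigenvalue_on V D l"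
    and dom: "\<And>x. (\<Sum>u\<in>V. x u * (\<Sum>w\<in>V. D u w * x w)) \<le> l * (\<Sum>u\<in>V. (x u)\<^sup>2)"
    using symmetric_eigenvalue_dominating_form[OF fin ne, of D, OF Dsym] by blast
  have "finite {mu. eigenvalue_on V D mu}"
    by (rule symmetric_eigenvalues_finite[OF fin]) (rule Dsym)
  hence "l \<le> dist_spectral_radius V E"
    using l unfolding dist_spectral_radius_def dist_eigenvalue_iff D_def by (intro Max_ge) auto
  hence "real n * l \<le> real n * dist_spectral_radius V E" by (rule mult_left_mono) simp
  moreover have "(\<Sum>u\<in>V. \<Sum>w\<in>V. D u w) \<le> real n * l" using dom[of "\<lambda>_. 1"] n by (simp add: mult.commute)
  moreover have "real (n - 1) + real (n - 1 - degree V E u) \<le> (\<Sum>w\<in>V. D u w)" if u: "u \<in> V" for u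
  proof -
    have c: "card (V - {u}) = n - 1" using u fin n by simp
    have N: "{w \<in> V. E u w} = (V - {u}) \<inter> {w. E u w}" using irr by auto
    have "(n - 1) + (n - 1 - degree V E u) = card (V - {u}) + card ((V - {u}) - {w. E u w})"
      unfolding degree_def N using c fin by (simp add: card_Diff_subset_Int)
    also have "card ((V - {u}) - {w. E u w}) = (\<Sum>w\<in>V - {u}. if E u w then 0 else 1)"
      using fin by (simp add: sum.If_cases Diff_eq)
    also have "card (V - {u}) + \<dots> = (\<Sum>w\<in>V - {u}. if E u w then 1 else 2)"
      unfolding card_eq_sum sum.distrib[symmetric] by (intro sum.cong) auto
    also have "\<dots> \<le> (\<Sum>w\<in>V - {u}. gdist V E u w)"
      using gdist_lower[OF G(2) u] by (intro sum_mono) blast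
    also have "\<dots> \<le> (\<Sum>w\<in>V. gdist V E u w)" by (rule sum_mono2) (use fin in auto)
    finally show ?thesis unfolding D_def by (simp flip: of_nat_sum of_nat_add del: of_nat_diff)
  qed
  hence "(\<Sum>u\<in>V. real (n - 1) + real (n - 1 - degree V E u)) \<le> (\<Sum>u\<in>V. \<Sum>w\<in>V. D u w)"
    by (rule sum_mono)
  ultimately show ?thesis using n by (simp add: sum.distrib del: of_nat_diff)
qed

section \<open>Upper bound for the extremal graph\<close>

lemma gdist_ext_edge_le:
  assumes "0 < d" "d \<le> n" "u < n" "v < n"
  shows "gdist (ext_vertices n) (ext_edge n d) u v \<le> (if u = v then 0 else if ext_edge n d u v then 1 else 2)"
proof (cases "u = v")
  case True
  have "walk_of_length (ext_vertices n) (ext_edge n d) u u 0"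
    unfolding walk_of_length_def by (rule exI[of _ "[u]"]) (use assms in \<open>simp add: ext_vertices_def\<close>)
  thus ?thesis using gdist_le True by force
next
  case False
  show ?thesis
  proof (cases "ext_edge n d u v")
    case True
    have "walk_of_length (ext_vertices n) (ext_edge n d) u v 1"
      unfolding walk_of_length_def
      by (rule exI[of _ "[u, v]"]) (use assms True in \<open>simp add: ext_vertices_def\<close>)
    thus ?thesis using gdist_le True False by force
  next
    case nadj: False
    \<comment> \<open>Since \<open>0 < d\<close>, vertex 0 belongs to the joined clique and is
      adjacent to every other vertex.\<close>
    have "walk_of_length (ext_vertices n) (ext_edge n d) u v 2"
      unfolding walk_of_length_def
      by (rule exI[of _ "[u, 0, v]"])
         (use assms nadj False in \<open>auto simp: ext_vertices_def ext_edge_def less_Suc_eq numeral_2_eq_2\<close>)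
    thus ?thesis using gdist_le nadj False by force
  qed
qed

text \<open>The bound follows from a positive supersolution for the eigenvalue n - 1 +
  \<open>\<mu>\<close>, where \<open>\<mu>\<close> is the right-hand excess divided by n. Entrywise
  upper bounds \<open>b\<close> on the distances suffice to verify it, because the vector is
  positive.\<close>

lemma dist_spectral_radius_ext_le:
  assumes k: "k \<ge> 1" and n: "n \<ge> 8 * k + 2" and d: "d = k + 1"
  shows "real n * dist_spectral_radius (ext_vertices n) (ext_edge n d)
       \<le> real n * (real n - 1) + 3 * real k * (real n - 2 * real k - 1)"
proof -
  let ?V = "ext_vertices n" and ?E = "ext_edge n d"
  define D where "D u w = real (gdist ?V ?E u w)" for u w
  have fin: "finite ?V" and ne: "?V \<noteq> {}" using n by (auto simp: ext_vertices_def)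
  have Dsym: "D u w = D w u" for u w
    unfolding D_def using gdist_commute[of ?E ?V u w] by (auto simp: ext_edge_def)
  have fe: "finite {mu. eigenvalue_on ?V D mu}"
    by (rule symmetric_eigenvalues_finite[OF fin]) (rule Dsym)
  obtain l where "eigenvalue_on ?V D l"
    using symmetric_eigenvalue_dominating_form[OF fin ne, of D, OF Dsym] by blast
  hence "{mu. eigenvalue_on ?V D mu} \<noteq> {}" by auto
  hence ev: "eigenvalue_on ?V D (dist_spectral_radius ?V ?E)"
    using Max_in[OF fe] unfolding dist_spectral_radius_def dist_eigenvalue_iff D_def by simp
  define \<kappa> where "\<kappa> = real k"
  define \<nu> where "\<nu> = real n"
  have kn: "\<kappa> \<ge> 1" "\<nu> \<ge> 8 * \<kappa> + 2" using k n unfolding \<kappa>_def \<nu>_def by linarith+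
  define \<mu> where "\<mu> = 3 * \<kappa> * (\<nu> - 2 * \<kappa> - 1) / \<nu>"
  \<comment> \<open>The value \<open>c\<close> makes the rows of the big clique hold with equality.
    Rows of the joined clique are smaller by \<open>\<kappa> * c\<close>; the rows of the
    independent vertices, multiplied by \<open>2 * \<kappa>\<close>, become the inequality
    \<open>key\<close>.\<close>
  define c where "c = (\<mu> + \<kappa>) / (2 * \<kappa>)"
  define y where "y i = (if i < n - k then 1 else c)" for i
  define b where "b u w = (if u = w then 0 else if ?E u w then 1 else (2::real))" for u w
  have \<nu>0: "\<nu> > 0" using kn by linarith
  have \<mu>\<nu>: "\<mu> * \<nu> = 3 * \<kappa> * (\<nu> - 2 * \<kappa> - 1)" using \<nu>0 by (simp add: \<mu>_def)
  \<comment> \<open>The bound \<open>2 * \<kappa> \<le> \<mu>\<close> amounts to n being at least 6k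
    + 3, which 8k + 2 guarantees for positive k.\<close>
  have "0 \<le> \<kappa> * (\<nu> - 6 * \<kappa> - 3)" using kn by (intro mult_nonneg_nonneg) linarith+
  hence "2 * \<kappa> * \<nu> \<le> \<mu> * \<nu>" unfolding \<mu>\<nu> by (simp add: algebra_simps)
  hence mu2: "\<mu> \<ge> 2 * \<kappa>" using \<nu>0 by (rule mult_right_le_imp_le)
  have key: "(\<mu> + \<kappa>) * (\<nu> - 1 + \<mu>) \<ge> 2 * \<kappa> * (2 * \<nu> - 3 * \<kappa> - 1) + 2 * (\<kappa> - 1) * (\<mu> + \<kappa>)"
  proof -
    have "0 \<le> (\<mu> - 2 * \<kappa>) * (\<mu> + \<kappa>) + \<mu>"
      using mu2 kn by (intro add_nonneg_nonneg mult_nonneg_nonneg) linarith+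
    also have "\<dots> = (\<mu> + \<kappa>) * (\<nu> - 1 + \<mu>) - (2 * \<kappa> * (2 * \<nu> - 3 * \<kappa> - 1) + 2 * (\<kappa> - 1) * (\<mu> + \<kappa>))
        + (3 * \<kappa> * (\<nu> - 2 * \<kappa> - 1) - \<mu> * \<nu>)"
      by (simp add: algebra_simps)
    finally show ?thesis using \<mu>\<nu> by simp
  qed
  have c0: "c > 0" and kc: "2 * \<kappa> * c = \<mu> + \<kappa>" using kn mu2 by (auto simp: c_def)
  have Db: "D u w \<le> b u w" if "u < n" "w < n" for u w
  proof -
    have "gdist ?V ?E u w \<le> (if u = w then 0 else if ?E u w then 1 else 2)"
      by (rule gdist_ext_edge_le) (use that d n in auto)
    thus ?thesis unfolding D_def b_def by (auto split: if_splits)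
  qed
  have split: "(\<Sum>w\<in>?V. f w) = (\<Sum>w\<in>{0..<d}. f w) + (\<Sum>w\<in>{d..<n-k}. f w) + (\<Sum>w\<in>{n-k..<n}. f w)" for f :: "nat \<Rightarrow> real"
    unfolding ext_vertices_def
    using n d sum.atLeastLessThan_concat[of 0 d "n - k" f] sum.atLeastLessThan_concat[of 0 "n - k" n f]
    by simp
  have own: "(\<Sum>w\<in>{p..<q}. if u = w then 0 else r) = r * (real q - real p - 1)" if "p \<le> u" "u < q" for p q u and r :: real
  proof -
    have "(\<Sum>w\<in>{p..<q}. if u = w then 0 else r) = (\<Sum>w\<in>{p..<q} - {u}. if u = w then 0 else r)"
      using that by (subst sum.remove[of _ u]) auto
    also have "\<dots> = (\<Sum>w\<in>{p..<q} - {u}. r)" by (rule sum.cong) auto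
    finally show ?thesis using that by (simp add: of_nat_diff)
  qed
  have "(\<Sum>w\<in>?V. D u w * y w) \<le> (\<nu> - 1 + \<mu>) * y u" if u: "u \<in> ?V" for u
  proof -
    have un: "u < n" using u by (simp add: ext_vertices_def)
    have "(\<Sum>w\<in>?V. D u w * y w) \<le> (\<Sum>w\<in>?V. b u w * y w)"
      by (rule sum_mono, rule mult_right_mono, rule Db)
         (use un c0 in \<open>auto simp: ext_vertices_def y_def\<close>)
    also have "\<dots> \<le> (\<nu> - 1 + \<mu>) * y u"
    proof -
      consider "u < d" | "d \<le> u" "u < n - k" | "n - k \<le> u" by linarith
      thus ?thesis
      proof cases
        case 1
        have "(\<Sum>w\<in>{0..<d}. b u w * y w) = (\<Sum>w\<in>{0..<d}. if u = w then 0 else 1)"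
          by (intro sum.cong refl) (use 1 n d in \<open>auto simp: b_def y_def ext_edge_def\<close>)
        moreover have "(\<Sum>w\<in>{d..<n-k}. b u w * y w) = (\<Sum>w\<in>{d..<n-k}. 1)"
          by (intro sum.cong refl) (use 1 n d in \<open>auto simp: b_def y_def ext_edge_def\<close>)
        moreover have "(\<Sum>w\<in>{n-k..<n}. b u w * y w) = (\<Sum>w\<in>{n-k..<n}. c)"
          by (intro sum.cong refl) (use 1 n d in \<open>auto simp: b_def y_def ext_edge_def\<close>)
        ultimately have "(\<Sum>w\<in>?V. b u w * y w) = \<kappa> + (\<nu> - 2 * \<kappa> - 1) + \<kappa> * c"
          unfolding split using 1 own[of 0 u d 1] n d
          by (simp add: \<kappa>_def \<nu>_def of_nat_diff)
        also have "\<dots> \<le> \<nu> - 1 + \<mu>" using kc mu2 kn by linarith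
        finally show ?thesis using 1 n d by (simp add: y_def)
      next
        case 2
        have "(\<Sum>w\<in>{0..<d}. b u w * y w) = (\<Sum>w\<in>{0..<d}. 1)"
          by (intro sum.cong refl) (use 2 n d in \<open>auto simp: b_def y_def ext_edge_def\<close>)
        moreover have "(\<Sum>w\<in>{d..<n-k}. b u w * y w) = (\<Sum>w\<in>{d..<n-k}. if u = w then 0 else 1)"
          by (intro sum.cong refl) (use 2 n d in \<open>auto simp: b_def y_def ext_edge_def\<close>)
        moreover have "(\<Sum>w\<in>{n-k..<n}. b u w * y w) = (\<Sum>w\<in>{n-k..<n}. 2 * c)"
          by (intro sum.cong refl) (use 2 n d in \<open>auto simp: b_def y_def ext_edge_def\<close>)
        ultimately have "(\<Sum>w\<in>?V. b u w * y w) = (\<kappa> + 1) + (\<nu> - 2 * \<kappa> - 2) + 2 * \<kappa> * c"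
          unfolding split using 2 own[of d u "n-k" 1] n d
          by (simp add: \<kappa>_def \<nu>_def of_nat_diff)
        also have "\<dots> \<le> \<nu> - 1 + \<mu>" using kc mu2 kn by linarith
        finally show ?thesis using 2 n d by (simp add: y_def)
      next
        case 3
        have "(\<Sum>w\<in>{0..<d}. b u w * y w) = (\<Sum>w\<in>{0..<d}. 1)"
          by (intro sum.cong refl) (use 3 un n d in \<open>auto simp: b_def y_def ext_edge_def\<close>)
        moreover have "(\<Sum>w\<in>{d..<n-k}. b u w * y w) = (\<Sum>w\<in>{d..<n-k}. 2)"
          by (intro sum.cong refl) (use 3 un n d in \<open>auto simp: b_def y_def ext_edge_def\<close>)
        moreover have "(\<Sum>w\<in>{n-k..<n}. b u w * y w) = (\<Sum>w\<in>{n-k..<n}. if u = w then 0 else 2 * c)"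
          by (intro sum.cong refl) (use 3 un n d in \<open>auto simp: b_def y_def ext_edge_def\<close>)
        ultimately have "(\<Sum>w\<in>?V. b u w * y w) = (\<kappa> + 1) + 2 * (\<nu> - 2 * \<kappa> - 1) + 2 * c * (\<kappa> - 1)"
          unfolding split using 3 un own[of "n-k" u n "2 * c"] n d
          by (simp add: \<kappa>_def \<nu>_def of_nat_diff)
        also have "\<dots> \<le> (\<nu> - 1 + \<mu>) * c"
        proof -
          have "2 * \<kappa> * ((\<kappa> + 1) + 2 * (\<nu> - 2 * \<kappa> - 1) + 2 * c * (\<kappa> - 1))
             = 2 * \<kappa> * (2 * \<nu> - 3 * \<kappa> - 1) + 2 * (\<kappa> - 1) * (2 * \<kappa> * c)" by (simp add: algebra_simps)
          also have "\<dots> \<le> (2 * \<kappa> * c) * (\<nu> - 1 + \<mu>)" using key unfolding kc .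
          also have "\<dots> = 2 * \<kappa> * ((\<nu> - 1 + \<mu>) * c)" by simp
          finally show ?thesis using kn by (simp add: mult_le_cancel_left)
        qed
        finally show ?thesis using 3 by (simp add: y_def)
      qed
    qed
    finally show ?thesis .
  qed
  hence "dist_spectral_radius ?V ?E \<le> \<nu> - 1 + \<mu>"
    by (intro eigenvalue_le_of_positive_supersolution[OF fin _ _ _ ev, of y])
       (use c0 in \<open>auto simp: D_def y_def\<close>)
  hence "\<nu> * dist_spectral_radius ?V ?E \<le> \<nu> * (\<nu> - 1 + \<mu>)"
    by (rule mult_left_mono) (use \<nu>0 in linarith)
  also have "\<dots> = \<nu> * (\<nu> - 1) + \<mu> * \<nu>" by (simp add: algebra_simps)
  finally show ?thesis unfolding \<mu>\<nu> unfolding \<nu>_def \<kappa>_def .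
qed

section \<open>Edge sets and parity\<close>

definition incident :: "'a set set \<Rightarrow> 'a \<Rightarrow> 'a set set" where
  "incident S v = {e \<in> S. v \<in> e}"

definition edge_degree :: "'a set set \<Rightarrow> 'a \<Rightarrow> nat" where
  "edge_degree S v = card (incident S v)"

definition even_subgraph :: "'a set set \<Rightarrow> bool" where
  "even_subgraph S \<longleftrightarrow> (\<forall>v. even (edge_degree S v))"

definition symm_diff :: "'a set \<Rightarrow> 'a set \<Rightarrow> 'a set" where
  "symm_diff S T = (S - T) \<union> (T - S)"

definition nbrs :: "'a set set \<Rightarrow> 'a \<Rightarrow> 'a set" where
  "nbrs S x = {w. {x, w} \<in> S}"

lemma edge_degree_empty [simp]: "edge_degree {} v = 0"
  by (simp add: edge_degree_def incident_def)

lemma edge_degree_insert: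
  assumes "finite S" "e \<notin> S"
  shows "edge_degree (insert e S) v = edge_degree S v + (if v \<in> e then 1 else 0)"
proof -
  have "incident (insert e S) v = (if v \<in> e then insert e (incident S v) else incident S v)"
    by (auto simp: incident_def)
  thus ?thesis using assms by (auto simp: edge_degree_def incident_def)
qed

lemma edge_degree_mono: "finite T \<Longrightarrow> S \<subseteq> T \<Longrightarrow> edge_degree S v \<le> edge_degree T v"
  unfolding edge_degree_def by (rule card_mono) (auto simp: incident_def)

lemma edge_degree_pos_iff: "finite S \<Longrightarrow> edge_degree S v > 0 \<longleftrightarrow> (\<exists>e\<in>S. v \<in> e)"
  unfolding edge_degree_def by (auto simp: card_gt_0_iff incident_def)

lemma edge_degree_symm_diff_parity:
  assumes "finite S" "finite T"
  shows "even (edge_degree (symm_diff S T) v) \<longleftrightarrow> even (edge_degree S v + edge_degree T v)"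
proof -
  have "incident (symm_diff S T) v = (incident S v - incident T v) \<union> (incident T v - incident S v)"
    by (auto simp: incident_def symm_diff_def)
  hence "edge_degree (symm_diff S T) v
      = card (incident S v - incident T v) + card (incident T v - incident S v)"
    unfolding edge_degree_def by (subst card_Un_disjoint[symmetric]) (use assms in \<open>auto simp: incident_def\<close>)
  moreover have "edge_degree S v = card (incident S v - incident T v) + card (incident S v \<inter> incident T v)"
    unfolding edge_degree_def
    by (subst card_Un_disjoint[symmetric]) (use assms in \<open>auto simp: incident_def intro!: arg_cong[where f=card]\<close>)
  moreover have "edge_degree T v = card (incident T v - incident S v) + card (incident S v \<inter> incident T v)"
    unfolding edge_degree_def
    by (subst card_Un_disjoint[symmetric]) (use assms in \<open>auto simp: incident_def intro!: arg_cong[where f=card]\<close>)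
  ultimately show ?thesis by presburger
qed

lemma handshake:
  assumes "finite S" "finite T" "\<And>e. e \<in> T \<Longrightarrow> e \<subseteq> S \<and> card e = 2"
  shows "(\<Sum>v\<in>S. edge_degree T v) = 2 * card T"
proof -
  have "(\<Sum>v\<in>S. edge_degree T v) = (\<Sum>v\<in>S. \<Sum>e\<in>T. if v \<in> e then 1 else 0)"
    unfolding edge_degree_def incident_def using assms(2)
    by (intro sum.cong refl) (simp add: sum.If_cases Int_def)
  also have "\<dots> = (\<Sum>e\<in>T. \<Sum>v\<in>S. if v \<in> e then 1 else 0)" by (rule sum.swap)
  also have "\<dots> = (\<Sum>e\<in>T. 2)"
  proof (rule sum.cong[OF refl])
    fix e assume "e \<in> T"
    hence "S \<inter> e = e" "card e = 2" using assms(3) by auto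
    thus "(\<Sum>v\<in>S. if v \<in> e then 1 else 0) = (2::nat)" using assms(1) by (simp add: sum.If_cases)
  qed
  finally show ?thesis by simp
qed

text \<open>Pigeonhole on parity vectors: two edge subsets with equal degree parities
  have an even symmetric difference.\<close>
lemma card_less_if_no_even_subgraph:
  assumes "finite S" "S \<noteq> {}" "finite T" and T: "\<And>e. e \<in> T \<Longrightarrow> e \<subseteq> S \<and> card e = 2"
    and no_even: "\<And>C. C \<subseteq> T \<Longrightarrow> even_subgraph C \<Longrightarrow> C = {}"
  shows "card T < card S"
proof -
  obtain s where s: "s \<in> S" using assms(2) by auto
  \<comment> \<open>The parity at \<open>s\<close> is left out because the handshake identity
    recovers it from the others. This halves the number of parity vectors and makes the bound
    strict.\<close>
  define f where "f X = {v \<in> S - {s}. odd (edge_degree X v)}" for X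
  have "inj_on f (Pow T)"
  proof (rule inj_onI)
    fix X Y assume X: "X \<in> Pow T" and Y: "Y \<in> Pow T" and eq: "f X = f Y"
    have fXY: "finite X" "finite Y" using X Y assms(3) by (auto intro: finite_subset)
    define C where "C = symm_diff X Y"
    have C: "C \<subseteq> T" using X Y by (auto simp: C_def symm_diff_def)
    have ev: "even (edge_degree C v)" if "v \<noteq> s" for v
    proof (cases "v \<in> S")
      case True
      hence "even (edge_degree X v) = even (edge_degree Y v)" using eq that unfolding f_def by blast
      thus ?thesis unfolding C_def using edge_degree_symm_diff_parity[OF fXY] by simp
    next
      case False
      hence "incident C v = {}" using C T by (auto simp: incident_def)
      thus ?thesis by (simp add: edge_degree_def)
    qed
    have "(\<Sum>v\<in>S. edge_degree C v) = 2 * card C"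
      by (rule handshake) (use assms(1,3) C T in \<open>auto intro: finite_subset\<close>)
    moreover have "(\<Sum>v\<in>S. edge_degree C v) = edge_degree C s + (\<Sum>v\<in>S - {s}. edge_degree C v)"
      using assms(1) s by (rule sum.remove)
    moreover have "even (\<Sum>v\<in>S - {s}. edge_degree C v)" by (rule dvd_sum) (use ev in auto)
    ultimately have "even (edge_degree C s)" by (metis dvd_add_left_iff dvd_triv_left)
    hence "even_subgraph C" using ev unfolding even_subgraph_def by metis
    hence "C = {}" using no_even C by blast
    thus "X = Y" unfolding C_def symm_diff_def by auto
  qed
  moreover have "f ` Pow T \<subseteq> Pow (S - {s})" by (auto simp: f_def)
  ultimately have "card (Pow T) \<le> card (Pow (S - {s}))" using assms(1) by (intro card_inj_on_le) auto
  hence "card T \<le> card (S - {s})" using assms(1,3) by (simp add: card_Pow)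
  moreover have "card (S - {s}) < card S" using assms(1) s by (rule card_Diff1_less)
  ultimately show ?thesis by simp
qed

lemma edge_degree_eq_card_nbrs:
  assumes "\<And>e. e \<in> S \<Longrightarrow> card e = 2"
  shows "edge_degree S x = card (nbrs S x)"
proof -
  have "bij_betw (\<lambda>w. {x, w}) (nbrs S x) (incident S x)"
  proof (rule bij_betwI')
    show "({x, w} = {x, w'}) = (w = w')" for w w' by (auto simp: doubleton_eq_iff)
    show "w \<in> nbrs S x \<Longrightarrow> {x, w} \<in> incident S x" for w by (simp add: nbrs_def incident_def)
    fix e assume e: "e \<in> incident S x"
    then obtain a b where "e = {a, b}" using assms[of e] unfolding incident_def by (auto simp: card_2_iff)
    thus "\<exists>w\<in>nbrs S x. e = {x, w}" using e by (auto simp: incident_def nbrs_def insert_commute)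
  qed
  thus ?thesis by (simp add: edge_degree_def bij_betw_same_card)
qed

section \<open>Paths and cycles as edge sets\<close>

fun path_edges :: "'a list \<Rightarrow> 'a set set" where
  "path_edges [] = {}"
| "path_edges [x] = {}"
| "path_edges (x # y # xs) = insert {x, y} (path_edges (y # xs))"

lemma finite_path_edges [simp]: "finite (path_edges xs)"
  by (induction xs rule: path_edges.induct) auto

lemma path_edges_subset_set: "e \<in> path_edges xs \<Longrightarrow> e \<subseteq> set xs"
  by (induction xs rule: path_edges.induct) auto

lemma path_edges_subset_iff: "path_edges xs \<subseteq> S \<longleftrightarrow> successively (\<lambda>x y. {x, y} \<in> S) xs"
  by (induction xs rule: path_edges.induct) auto

lemma path_edges_append:
  "path_edges (xs @ ys) = path_edges xs \<union> path_edges ys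
     \<union> (if xs = [] \<or> ys = [] then {} else {{last xs, hd ys}})"
proof (induction xs rule: path_edges.induct)
  case (2 x)
  show ?case by (cases ys) auto
qed auto

lemma edge_degree_path_edges:
  assumes "distinct xs"
  shows "edge_degree (path_edges xs) z = (if z \<notin> set xs \<or> length xs \<le> 1 then 0
           else if z = hd xs \<or> z = last xs then 1 else 2)"
  using assms
proof (induction xs rule: path_edges.induct)
  case (3 x y zs)
  have "{x, y} \<notin> path_edges (y # zs)" using path_edges_subset_set[of "{x, y}" "y # zs"] 3(2) by auto
  hence "edge_degree (path_edges (x # y # zs)) z
       = edge_degree (path_edges (y # zs)) z + (if z \<in> {x, y} then 1 else 0)"
    by (simp add: edge_degree_insert)
  moreover have "tl zs = [] \<or> last (tl zs) \<in> set (tl zs)" using last_in_set by blast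
  hence "edge_degree (path_edges (y # zs)) z + (if z \<in> {x, y} then 1 else 0)
       = (if z \<notin> set (x # y # zs) \<or> length (x # y # zs) \<le> 1 then 0
           else if z = hd (x # y # zs) \<or> z = last (x # y # zs) then 1 else 2)"
    using 3 by (cases zs) auto
  ultimately show ?case by simp
qed auto

lemma path_edges_cover_tail: "x \<in> set xs \<Longrightarrow> \<exists>e\<in>path_edges (v # xs). x \<in> e"
  by (induction xs arbitrary: v) auto

lemma path_edges_cover_init: "x \<in> set xs \<Longrightarrow> \<exists>e\<in>path_edges (xs @ [v]). x \<in> e"
proof (induction xs)
  case (Cons a xs)
  thus ?case by (cases xs) auto
qed simp

text \<open>With at least two vertices in \<open>P\<close> the closing edge differs from all path
  edges; with a single one, the edge set would collapse to one edge and the degrees would be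
  odd.\<close>

lemma edge_degree_closed_path:
  assumes d: "distinct (v # P)" and len: "length P \<ge> 2"
  shows "edge_degree (path_edges (v # P @ [v])) z = (if z \<in> set (v # P) then 2 else 0)"
proof -
  obtain p P' where P: "P = p # P'" "P' \<noteq> []" using len by (cases P; cases "tl P") auto
  have "path_edges (v # P @ [v]) = insert {last P, v} (path_edges (v # P))"
    using path_edges_append[of "v # P" "[v]"] P by simp
  moreover have "{last P, v} \<notin> path_edges (v # P)"
  proof
    assume "{last P, v} \<in> path_edges (v # P)"
    moreover have "last P \<noteq> p" using P d by auto
    ultimately have "{last P, v} \<in> path_edges P" using P d by (auto simp: doubleton_eq_iff)
    thus False using path_edges_subset_set d by fastforce
  qed
  ultimately have "edge_degree (path_edges (v # P @ [v])) z
      = edge_degree (path_edges (v # P)) z + (if z \<in> {last P, v} then 1 else 0)"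
    by (simp add: edge_degree_insert)
  also have "\<dots> = (if z \<in> set (v # P) then 2 else 0)"
    unfolding edge_degree_path_edges[OF d] using P d by auto
  finally show ?thesis .
qed

text \<open>A step to a vertex already on the path truncates the path there. The last property keeps
  the path inside the component of \<open>x\<close>.\<close>

lemma rtranclp_distinct_path:
  assumes "R\<^sup>*\<^sup>* x y"
  obtains xs where "xs \<noteq> []" "hd xs = x" "last xs = y" "distinct xs" "successively R xs"
    "\<And>z. z \<in> set xs \<Longrightarrow> R\<^sup>*\<^sup>* x z"
proof -
  have "\<exists>xs. xs \<noteq> [] \<and> hd xs = x \<and> last xs = y \<and> distinct xs \<and> successively R xs \<and> (\<forall>z\<in>set xs. R\<^sup>*\<^sup>* x z)"
    using assms
  proof (induction rule: rtranclp_induct)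
    case base
    show ?case by (rule exI[of _ "[x]"]) simp
  next
    case (step y z)
    then obtain xs where xs: "xs \<noteq> []" "hd xs = x" "last xs = y" "distinct xs" "successively R xs"
      "\<forall>z\<in>set xs. R\<^sup>*\<^sup>* x z" by blast
    show ?case
    proof (cases "z \<in> set xs")
      case True
      then obtain ys zs where "xs = ys @ z # zs" by (auto simp: in_set_conv_decomp)
      moreover from this have "successively R (ys @ [z])" using xs(5) by (auto simp: successively_append_iff)
      moreover have "hd (ys @ [z]) = x" using xs(2) calculation(1) by (cases ys) auto
      ultimately show ?thesis using xs by (intro exI[of _ "ys @ [z]"]) auto
    next
      case False
      have "R\<^sup>*\<^sup>* x z" using step by auto
      thus ?thesis using xs step False
        by (intro exI[of _ "xs @ [z]"]) (auto simp: successively_append_iff)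
    qed
  qed
  thus ?thesis using that by blast
qed

lemma rtranclp_symmetric: "(\<And>x y. R x y \<Longrightarrow> R y x) \<Longrightarrow> R\<^sup>*\<^sup>* x y \<Longrightarrow> R\<^sup>*\<^sup>* y x"
  using symp_rtranclp[of R] unfolding symp_on_def by blast

section \<open>A maximal even subgraph with an uncovered vertex\<close>

text \<open>Maximality of \<open>F\<close> in the form in which it is used:
  \<open>complement_forest\<close> expresses that no even set of edges can be added,
  \<open>exchange\<close> that no even modification covers \<open>v\<close> for free. A forest is
  encoded as an edge set with no nonempty even subset.\<close>

locale uncovered_vertex =
  fixes V :: "'a set" and G F :: "'a set set" and v :: 'a
  assumes finite_V: "finite V"
    and edge: "e \<in> G \<Longrightarrow> e \<subseteq> V \<and> card e = 2"
    and F_subset: "F \<subseteq> G"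
    and F_even: "even_subgraph F"
    and complement_forest: "C \<subseteq> G - F \<Longrightarrow> even_subgraph C \<Longrightarrow> C = {}"
    and exchange: "C \<subseteq> G \<Longrightarrow> even_subgraph C \<Longrightarrow> edge_degree (symm_diff F C) v > 0 \<Longrightarrow>
      \<exists>x. edge_degree F x > 0 \<and> edge_degree (symm_diff F C) x = 0"
    and v_in_V: "v \<in> V" and v_uncovered: "edge_degree F v = 0"
begin

lemma finite_G: "finite G"
  by (rule finite_subset[of _ "Pow V"]) (use edge finite_V in auto)

lemma finite_F: "finite F"
  using F_subset finite_G finite_subset by blast

lemma nbrs_subset: "S \<subseteq> G \<Longrightarrow> nbrs S x \<subseteq> V - {x}"
proof
  fix w assume "S \<subseteq> G" "w \<in> nbrs S x"
  hence "{x, w} \<subseteq> V \<and> card {x, w} = 2" by (intro edge) (auto simp: nbrs_def)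
  thus "w \<in> V - {x}" by auto
qed

lemma finite_nbrs: "S \<subseteq> G \<Longrightarrow> finite (nbrs S x)"
  by (rule finite_subset[OF nbrs_subset]) (simp_all add: finite_V)

lemma edge_degree_nbrs: "S \<subseteq> G \<Longrightarrow> edge_degree S x = card (nbrs S x)"
  by (rule edge_degree_eq_card_nbrs) (use edge in auto)

lemma v_edge_notin_F: "{v, c} \<notin> F"
  using v_uncovered edge_degree_pos_iff[OF finite_F, of v] by auto

definition A :: "'a set" where
  "A = {x \<in> V. edge_degree F x \<ge> 4}"

lemma F_degree_le_2: "x \<in> V - A \<Longrightarrow> edge_degree F x \<le> 2"
proof -
  assume "x \<in> V - A"
  hence "edge_degree F x < 4" by (auto simp: A_def)
  moreover have "even (edge_degree F x)" using F_even by (simp add: even_subgraph_def)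
  ultimately show ?thesis by presburger
qed

text \<open>Exchanging F along the cycle uncovers no vertex: at a vertex of A the cycle uses only two
  of at least four F-edges, and every other vertex of the cycle keeps an edge outside F.\<close>
lemma no_exchange_cycle:
  assumes d: "distinct (v # P1 @ P2 @ P3)" and len: "length (P1 @ P2 @ P3) \<ge> 2"
    and G: "successively (\<lambda>x y. {x, y} \<in> G) (v # P1 @ P2 @ P3 @ [v])"
    and P1: "successively (\<lambda>x y. {x, y} \<in> G - F) (v # P1)"
    and P3: "successively (\<lambda>x y. {x, y} \<in> G - F) (P3 @ [v])"
    and P2: "set P2 \<subseteq> A"
  shows False
proof -
  define P where "P = P1 @ P2 @ P3"
  define C where "C = path_edges (v # P @ [v])"
  have P: "distinct (v # P)" "length P \<ge> 2" using d len by (auto simp: P_def)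
  have deg: "edge_degree C z = (if z \<in> set (v # P) then 2 else 0)" for z
    unfolding C_def by (rule edge_degree_closed_path[OF P])
  have C: "C \<subseteq> G" using G unfolding C_def P_def path_edges_subset_iff by simp
  have finC: "finite C" by (simp add: C_def)
  have evC: "even_subgraph C" by (simp add: even_subgraph_def deg)
  have finD: "finite (symm_diff F C)" using finite_F finC by (simp add: symm_diff_def)
  have pos: "edge_degree (symm_diff F C) x > 0" if "e \<in> C" "e \<notin> F" "x \<in> e" for x e
    unfolding edge_degree_pos_iff[OF finD] using that by (auto simp: symm_diff_def)
  have sub1: "path_edges (v # P1) \<subseteq> C"
    unfolding C_def P_def using path_edges_append[of "v # P1" "P2 @ P3 @ [v]"] by (simp add: subset_insertI2)
  have sub3: "path_edges (P3 @ [v]) \<subseteq> C"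
    unfolding C_def P_def using path_edges_append[of "v # P1 @ P2" "P3 @ [v]"] by (simp add: subset_insertI2)
  have nF1: "path_edges (v # P1) \<inter> F = {}" and nF3: "path_edges (P3 @ [v]) \<inter> F = {}"
    using P1 P3 unfolding path_edges_subset_iff[symmetric] by auto
  have "edge_degree C v > 0" using deg by simp
  then obtain e where "e \<in> C" "v \<in> e" using edge_degree_pos_iff[OF finC] by blast
  moreover have "e \<notin> F" using v_uncovered finite_F \<open>v \<in> e\<close> edge_degree_pos_iff[OF finite_F] by (metis less_irrefl)
  ultimately have "edge_degree (symm_diff F C) v > 0" by (intro pos)
  then obtain x where x: "edge_degree F x > 0" "edge_degree (symm_diff F C) x = 0"
    using exchange[OF C evC] by blast
  have inc: "incident F x \<subseteq> incident C x"
    using x(2) edge_degree_pos_iff[OF finD, of x] by (auto simp: symm_diff_def incident_def)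
  have "x \<in> set P"
  proof -
    have "edge_degree F x \<le> edge_degree C x"
      unfolding edge_degree_def by (rule card_mono[OF _ inc]) (use finC in \<open>simp add: incident_def\<close>)
    hence "x \<in> set (v # P)" using x(1) deg[of x] by (auto split: if_splits)
    thus ?thesis using x(1) v_uncovered by auto
  qed
  then consider "x \<in> set P1" | "x \<in> set P2" | "x \<in> set P3" unfolding P_def by auto
  thus False
  proof cases
    case 1
    then obtain e where "e \<in> path_edges (v # P1)" "x \<in> e" using path_edges_cover_tail by metis
    thus False using pos[of e x] sub1 nF1 x(2) by auto
  next
    case 2
    hence "4 \<le> edge_degree F x" using P2 by (auto simp: A_def)
    also have "\<dots> \<le> edge_degree C x"
      unfolding edge_degree_def by (rule card_mono[OF _ inc]) (use finC in \<open>simp add: incident_def\<close>)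
    finally show False using deg[of x] by (simp split: if_splits)
  next
    case 3
    then obtain e where "e \<in> path_edges (P3 @ [v])" "x \<in> e" using path_edges_cover_init by metis
    thus False using pos[of e x] sub3 nF3 x(2) by auto
  qed
qed

definition A_adj :: "'a \<Rightarrow> 'a \<Rightarrow> bool" where
  "A_adj x y \<longleftrightarrow> {x, y} \<in> G \<and> x \<in> A \<and> y \<in> A"

definition comp :: "'a \<Rightarrow> 'a set" where
  "comp z = {w. A_adj\<^sup>*\<^sup>* z w}"

lemma A_adj_sym: "A_adj x y \<Longrightarrow> A_adj y x"
  by (auto simp: A_adj_def insert_commute)

lemma comp_subset: "z \<in> A \<Longrightarrow> comp z \<subseteq> A"
proof
  fix w assume "z \<in> A" "w \<in> comp z"
  hence "A_adj\<^sup>*\<^sup>* z w" by (simp add: comp_def)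
  thus "w \<in> A" by (induction) (use \<open>z \<in> A\<close> in \<open>auto simp: A_adj_def\<close>)
qed

text \<open>If all components of the graph on \<open>A\<close> had fewer than n/2 vertices,
  F-degrees in \<open>A\<close> would stay below n/2 apart from edges leaving \<open>A\<close>.
  Those are few, since each vertex outside \<open>A\<close> receives at most two, and
  \<open>G\<close> adds fewer than n forest edges to \<open>F\<close>: too little for the assumed
  density.\<close>

lemma large_component:
  assumes n: "card V = n" "n \<ge> 10"
    and dense: "n * (n - 2) + 4 * (n - 1) < 2 * (\<Sum>x\<in>V. edge_degree G x)"
  obtains z where "z \<in> A" "n \<le> 2 * card (comp z)"
proof -
  have "\<exists>z\<in>A. n \<le> 2 * card (comp z)"
  proof (rule ccontr)
    assume small: "\<not> ?thesis"
    have AV: "A \<subseteq> V" by (auto simp: A_def)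
    have finA: "finite A" using AV finite_V finite_subset by blast
    have G_split: "edge_degree G x = edge_degree F x + edge_degree (G - F) x" for x
    proof -
      have "incident G x = incident F x \<union> incident (G - F) x" "incident F x \<inter> incident (G - F) x = {}"
        using F_subset by (auto simp: incident_def)
      thus ?thesis unfolding edge_degree_def using finite_G finite_F
        by (simp add: card_Un_disjoint incident_def)
    qed
    have "(\<Sum>x\<in>V. edge_degree (G - F) x) = 2 * card (G - F)"
      by (rule handshake) (use finite_V finite_G edge in auto)
    moreover have "card (G - F) < card V"
      by (rule card_less_if_no_even_subgraph)
         (use finite_V v_in_V finite_G edge complement_forest in auto)
    ultimately have forest: "(\<Sum>x\<in>V. edge_degree (G - F) x) \<le> 2 * (n - 1)" using n by simp
    define out where "out x = card (nbrs F x - A)" for x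
    have inA: "2 * edge_degree F x \<le> (n - 2) + 2 * out x" if x: "x \<in> A" for x
    proof -
      have "finite (comp x)" using comp_subset[OF x] finA finite_subset by blast
      moreover have "nbrs F x \<inter> A \<subseteq> comp x - {x}"
      proof
        fix w assume w: "w \<in> nbrs F x \<inter> A"
        hence "{x, w} \<in> G" using F_subset by (auto simp: nbrs_def)
        hence "A_adj x w" using w x by (simp add: A_adj_def)
        thus "w \<in> comp x - {x}" using w nbrs_subset[OF F_subset, of x] by (auto simp: comp_def)
      qed
      moreover have "x \<in> comp x" by (simp add: comp_def)
      ultimately have "card (nbrs F x \<inter> A) \<le> card (comp x) - 1"
        using card_mono[of "comp x - {x}" "nbrs F x \<inter> A"] by (simp add: card_Diff_singleton)
      moreover have "2 * card (comp x) < n" using small x by auto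
      moreover have "edge_degree F x = card (nbrs F x \<inter> A) + out x"
        unfolding out_def edge_degree_nbrs[OF F_subset]
        using finite_nbrs[OF F_subset, of x] by (simp add: card_Int_Diff)
      ultimately show ?thesis by linarith
    qed
    have "(\<Sum>x\<in>A. out x) \<le> (\<Sum>w\<in>V - A. edge_degree F w)"
    proof -
      have "(\<Sum>x\<in>A. out x) = (\<Sum>x\<in>A. \<Sum>w\<in>V - A. if {x, w} \<in> F then 1 else 0)"
      proof (intro sum.cong refl)
        fix x assume "x \<in> A"
        have "nbrs F x - A = (V - A) \<inter> {w. {x, w} \<in> F}"
          using nbrs_subset[OF F_subset, of x] by (auto simp: nbrs_def)
        thus "out x = (\<Sum>w\<in>V - A. if {x, w} \<in> F then 1 else 0)"
          using finite_V by (simp add: out_def sum.If_cases)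
      qed
      also have "\<dots> = (\<Sum>w\<in>V - A. \<Sum>x\<in>A. if {x, w} \<in> F then 1 else 0)" by (rule sum.swap)
      also have "\<dots> \<le> (\<Sum>w\<in>V - A. edge_degree F w)"
      proof (rule sum_mono)
        fix w
        have "(\<Sum>x\<in>A. if {x, w} \<in> F then 1 else 0) = card (A \<inter> {x. {x, w} \<in> F})"
          using finA by (simp add: sum.If_cases)
        also have "\<dots> \<le> card (nbrs F w)"
          by (rule card_mono[OF finite_nbrs[OF F_subset]]) (auto simp: nbrs_def insert_commute)
        finally show "(\<Sum>x\<in>A. if {x, w} \<in> F then 1 else 0) \<le> edge_degree F w"
          by (simp add: edge_degree_nbrs[OF F_subset])
      qed
      finally show ?thesis .
    qed
    moreover have out2: "(\<Sum>w\<in>V - A. edge_degree F w) \<le> card (V - A) * 2"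
      using sum_bounded_above[of "V - A" "edge_degree F" 2] F_degree_le_2 by simp
    moreover have "(\<Sum>x\<in>A. 2 * edge_degree F x) \<le> (\<Sum>x\<in>A. (n - 2) + 2 * out x)"
      by (rule sum_mono) (rule inA)
    hence "2 * (\<Sum>x\<in>A. edge_degree F x) \<le> card A * (n - 2) + 2 * (\<Sum>x\<in>A. out x)"
      by (simp add: sum.distrib sum_distrib_left)
    moreover have "(\<Sum>x\<in>V. edge_degree F x) = (\<Sum>x\<in>V - A. edge_degree F x) + (\<Sum>x\<in>A. edge_degree F x)"
      by (rule sum.subset_diff[OF AV finite_V])
    \<comment> \<open>In the doubled degree sum, a vertex outside \<open>A\<close> accounts for up
      to 4 by its own F-degree and up to 4 by F-edges arriving from \<open>A\<close>. The resulting
      8 is absorbed by n - 2, hence the requirement that n be at least 10.\<close>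
    moreover have "card (V - A) * 8 \<le> card (V - A) * (n - 2)" by (rule mult_le_mono2) (use n in simp)
    ultimately have "2 * (\<Sum>x\<in>V. edge_degree F x) \<le> card A * (n - 2) + card (V - A) * (n - 2)"
      by linarith
    also have "\<dots> = n * (n - 2)"
      using n card_mono[OF finite_V AV]
      by (simp add: card_Diff_subset[OF finA AV] add_mult_distrib[symmetric])
    finally have "2 * (\<Sum>x\<in>V. edge_degree F x) \<le> n * (n - 2)" .
    moreover have "(\<Sum>x\<in>V. edge_degree G x) = (\<Sum>x\<in>V. edge_degree F x) + (\<Sum>x\<in>V. edge_degree (G - F) x)"
      by (simp add: G_split sum.distrib)
    ultimately show False using dense forest by linarith
  qed
  thus ?thesis using that by blast
qed

section \<open>Branches of the forest at the uncovered vertex\<close>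

context
  fixes K :: "'a set"
  assumes K_subset: "K \<subseteq> A"
    and K_connected: "x \<in> K \<Longrightarrow> y \<in> K \<Longrightarrow> A_adj\<^sup>*\<^sup>* x y"
    and K_closed: "x \<in> A - K \<Longrightarrow> y \<in> K \<Longrightarrow> {x, y} \<notin> G"
begin

lemma v_notin_K: "v \<notin> K"
  using K_subset v_uncovered by (auto simp: A_def)

text \<open>Both \<open>v\<close> and \<open>K\<close> are removed from the forest, so that a path
  inside a branch never meets the other portions of an exchange cycle.\<close>

definition Phi_adj :: "'a \<Rightarrow> 'a \<Rightarrow> bool" where
  "Phi_adj x y \<longleftrightarrow> {x, y} \<in> G - F \<and> x \<notin> insert v K \<and> y \<notin> insert v K"

definition branch :: "'a \<Rightarrow> 'a set" where
  "branch c = {y. Phi_adj\<^sup>*\<^sup>* c y}"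

text \<open>Contact with \<open>K\<close> may be along any edge of \<open>G\<close>, including one
  of \<open>F\<close>: the last vertex before \<open>K\<close> keeps its forest edge on the side of
  \<open>v\<close>.\<close>

definition touches :: "'a \<Rightarrow> bool" where
  "touches c \<longleftrightarrow> c \<in> K \<or> (\<exists>x\<in>branch c. \<exists>z\<in>K. {x, z} \<in> G)"

lemma Phi_adj_sym: "Phi_adj x y \<Longrightarrow> Phi_adj y x"
  by (auto simp: Phi_adj_def insert_commute)

lemma branch_subset:
  assumes "c \<in> nbrs G v - K"
  shows "branch c \<subseteq> V - insert v K"
proof
  fix y assume "y \<in> branch c"
  hence "Phi_adj\<^sup>*\<^sup>* c y" by (simp add: branch_def)
  thus "y \<in> V - insert v K"
  proof induction
    case base
    thus ?case using assms nbrs_subset[of G v] by auto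
  next
    case (step y z)
    thus ?case using edge unfolding Phi_adj_def by auto
  qed
qed

lemma branch_path:
  assumes c: "c \<in> nbrs G v - K" and y: "y \<in> branch c"
  obtains P where "P \<noteq> []" "hd P = c" "last P = y" "distinct P" "set P \<subseteq> branch c"
    "successively (\<lambda>x y. {x, y} \<in> G - F) (v # P)"
proof -
  obtain P where P: "P \<noteq> []" "hd P = c" "last P = y" "distinct P" "successively Phi_adj P"
    "\<And>z. z \<in> set P \<Longrightarrow> Phi_adj\<^sup>*\<^sup>* c z"
    using rtranclp_distinct_path[of Phi_adj c y] y unfolding branch_def by blast
  have "successively (\<lambda>x y. {x, y} \<in> G - F) P"
    by (rule successively_mono[OF P(5)]) (auto simp: Phi_adj_def)
  hence "successively (\<lambda>x y. {x, y} \<in> G - F) (v # P)"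
    using P(1,2) c v_edge_notin_F by (simp add: successively_Cons nbrs_def)
  thus ?thesis using that P by (auto simp: branch_def)
qed

lemma successively_Phi_rev:
  "successively (\<lambda>x y. {x, y} \<in> S) xs \<Longrightarrow> successively (\<lambda>x y. {x, y} \<in> S) (rev xs)"
  unfolding successively_rev by (erule successively_mono) (metis insert_commute)

lemma successively_Phi_G:
  "successively (\<lambda>x y. {x, y} \<in> G - F) xs \<Longrightarrow> successively (\<lambda>x y. {x, y} \<in> G) xs"
  by (erule successively_mono) auto

text \<open>A common vertex would give a forest path from \<open>c\<close> to \<open>c'\<close>, and
  \<open>v\<close> closes it to a cycle lying entirely outside \<open>F\<close>.\<close>

lemma branches_disjoint:
  assumes c: "c \<in> nbrs G v - K" "c' \<in> nbrs G v - K" "c \<noteq> c'"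
  shows "branch c \<inter> branch c' = {}"
proof (rule ccontr)
  assume "branch c \<inter> branch c' \<noteq> {}"
  then obtain y where "Phi_adj\<^sup>*\<^sup>* c y" "Phi_adj\<^sup>*\<^sup>* c' y" by (auto simp: branch_def)
  hence "c' \<in> branch c"
    using rtranclp_symmetric[of Phi_adj c' y] Phi_adj_sym unfolding branch_def by auto
  then obtain P where P: "P \<noteq> []" "hd P = c" "last P = c'" "distinct P" "set P \<subseteq> branch c"
    "successively (\<lambda>x y. {x, y} \<in> G - F) (v # P)" using branch_path[OF c(1)] by metis
  have "length P \<ge> 2" using P(1-3) c(3) by (cases P; cases "tl P") auto
  moreover have "v \<notin> set P" using P(5) branch_subset[OF c(1)] by auto
  moreover have "successively (\<lambda>x y. {x, y} \<in> G) (v # P @ [v])"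
    using successively_Phi_G[OF P(6)] P(1,3) c(2)
    by (auto simp: successively_append_iff successively_Cons nbrs_def insert_commute)
  ultimately show False using no_exchange_cycle[of P "[]" "[]"] P by simp
qed

text \<open>An edge between two branches closes a cycle through \<open>v\<close>. That edge may
  belong to \<open>F\<close>, as both of its ends stay covered by the forest edges leading back to
  \<open>v\<close>.\<close>

lemma branches_nonadjacent:
  assumes c: "c \<in> nbrs G v - K" "c' \<in> nbrs G v - K" "c \<noteq> c'"
    and xy: "x \<in> branch c" "y \<in> branch c'"
  shows "{x, y} \<notin> G"
proof
  assume xyG: "{x, y} \<in> G"
  obtain P where P: "P \<noteq> []" "hd P = c" "last P = x" "distinct P" "set P \<subseteq> branch c"
    "successively (\<lambda>x y. {x, y} \<in> G - F) (v # P)" using branch_path[OF c(1) xy(1)] by metis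
  obtain Q where Q: "Q \<noteq> []" "hd Q = c'" "last Q = y" "distinct Q" "set Q \<subseteq> branch c'"
    "successively (\<lambda>x y. {x, y} \<in> G - F) (v # Q)" using branch_path[OF c(2) xy(2)] by metis
  have Q': "successively (\<lambda>x y. {x, y} \<in> G - F) (rev Q @ [v])"
    using successively_Phi_rev[OF Q(6)] by simp
  have "distinct (v # P @ rev Q)"
    using P(4,5) Q(4,5) branches_disjoint[OF c] branch_subset[OF c(1)] branch_subset[OF c(2)] by auto
  moreover have "length (P @ rev Q) \<ge> 2" using P(1) Q(1) by (cases P; cases Q) auto
  moreover have "successively (\<lambda>x y. {x, y} \<in> G) ((v # P) @ (rev Q @ [v]))"
    unfolding successively_append_iff[of _ "v # P"]
    using successively_Phi_G[OF P(6)] successively_Phi_G[OF Q'] P(1,3) Q(1,3) xyG by (simp add: hd_rev)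
  ultimately show False using no_exchange_cycle[of P "[]" "rev Q"] P(6) Q' by simp
qed

text \<open>One format for both kinds of contact: \<open>P\<close> is empty when \<open>c\<close>
  itself lies in \<open>K\<close>, and \<open>hd (P @ [z]) = c\<close> still recovers
  \<open>c\<close>.\<close>

lemma touching_path:
  assumes c: "c \<in> nbrs G v" and t: "touches c"
  obtains P z where "z \<in> K" "distinct P" "hd (P @ [z]) = c" "P = [] \<or> c \<notin> K \<and> set P \<subseteq> branch c"
    "successively (\<lambda>x y. {x, y} \<in> G - F) (v # P)" "{last (v # P), z} \<in> G"
proof (cases "c \<in> K")
  case True
  thus ?thesis using that[of c "[]"] c by (simp add: nbrs_def)
next
  case False
  then obtain x z where xz: "x \<in> branch c" "z \<in> K" "{x, z} \<in> G" using t unfolding touches_def by blast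
  have c': "c \<in> nbrs G v - K" using c False by simp
  obtain P where P: "P \<noteq> []" "hd P = c" "last P = x" "distinct P" "set P \<subseteq> branch c"
    "successively (\<lambda>x y. {x, y} \<in> G - F) (v # P)" using branch_path[OF c' xz(1)] by metis
  thus ?thesis using that[of z P] xz False by simp
qed

text \<open>Two contacts are joined by a path \<open>M\<close> inside \<open>K\<close>, which closes
  a cycle through \<open>v\<close>. Whether the edges of \<open>M\<close> lie in \<open>F\<close> is
  irrelevant, because every vertex of \<open>M\<close> has F-degree at least 4.\<close>

lemma touching_unique:
  assumes c: "c \<in> nbrs G v" "c' \<in> nbrs G v" "touches c" "touches c'"
  shows "c = c'"
proof (rule ccontr)
  assume neq: "c \<noteq> c'"
  obtain P z where P: "z \<in> K" "distinct P" "hd (P @ [z]) = c" "P = [] \<or> c \<notin> K \<and> set P \<subseteq> branch c"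
    "successively (\<lambda>x y. {x, y} \<in> G - F) (v # P)" "{last (v # P), z} \<in> G"
    using touching_path[OF c(1,3)] by metis
  obtain Q y where Q: "y \<in> K" "distinct Q" "hd (Q @ [y]) = c'" "Q = [] \<or> c' \<notin> K \<and> set Q \<subseteq> branch c'"
    "successively (\<lambda>x y. {x, y} \<in> G - F) (v # Q)" "{last (v # Q), y} \<in> G"
    using touching_path[OF c(2,4)] by metis
  obtain M where M: "M \<noteq> []" "hd M = z" "last M = y" "distinct M" "successively A_adj M"
    "\<And>w. w \<in> set M \<Longrightarrow> A_adj\<^sup>*\<^sup>* z w"
    using rtranclp_distinct_path[OF K_connected[OF P(1) Q(1)]] by metis
  have MK: "set M \<subseteq> K"
  proof
    fix w assume "w \<in> set M"
    hence "A_adj\<^sup>*\<^sup>* z w" by (rule M(6))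
    thus "w \<in> K"
    proof induction
      case base
      show ?case by (rule P(1))
    next
      case (step w w')
      thus ?case using K_closed[of w' w] by (auto simp: A_adj_def insert_commute)
    qed
  qed
  have Q': "successively (\<lambda>x y. {x, y} \<in> G - F) (rev Q @ [v])"
    using successively_Phi_rev[OF Q(5)] by simp
  have Pb: "set P \<subseteq> V - insert v K" using P(4) branch_subset[of c] c(1) by auto
  have Qb: "set Q \<subseteq> V - insert v K" using Q(4) branch_subset[of c'] c(2) by auto
  have PQ: "set P \<inter> set Q = {}" using P(4) Q(4) branches_disjoint[of c c'] c(1,2) neq by auto
  have "distinct (v # P @ M @ rev Q)"
    using P(2) M(4) Q(2) Pb Qb PQ MK v_notin_K by auto
  \<comment> \<open>A shorter cycle would consist of \<open>v\<close> and one vertex of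
    \<open>K\<close>, with \<open>P\<close> and \<open>Q\<close> empty, and would force
    \<open>c = c'\<close>.\<close>
  moreover have "length (P @ M @ rev Q) \<ge> 2"
  proof (rule ccontr)
    assume "\<not> ?thesis"
    hence "length P + length M + length Q < 2" by simp
    moreover have "0 < length M" using M(1) by (rule length_greater_0_conv[THEN iffD2])
    ultimately have "length P = 0" "length Q = 0" "length M = Suc 0" by linarith+
    thus False using M(2,3) P(3) Q(3) neq by (auto simp: length_Suc_conv)
  qed
  moreover have "successively (\<lambda>x y. {x, y} \<in> G) ((v # P) @ M @ (rev Q @ [v]))"
  proof -
    have "successively (\<lambda>x y. {x, y} \<in> G) M"
      by (rule successively_mono[OF M(5)]) (auto simp: A_adj_def)
    moreover have "hd (rev Q @ [v]) = last (v # Q)" by (cases Q rule: rev_cases) auto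
    ultimately show ?thesis
      unfolding successively_append_iff[of _ "v # P"] successively_append_iff[of _ M]
      using successively_Phi_G[OF P(5)] successively_Phi_G[OF Q'] M(1-3) P(6) Q(6)
      by (auto simp: insert_commute)
  qed
  ultimately show False using no_exchange_cycle[of P M "rev Q"] P(5) Q' MK K_subset by auto
qed

text \<open>The witness \<open>m\<close> is the number of vertices outside \<open>K\<close> other
  than \<open>v\<close> and those in k chosen non-touching branches. Apart from at most one edge at
  \<open>v\<close>, only these \<open>m\<close> vertices send edges to \<open>K\<close>: at most two
  each from \<open>F\<close>, together with a forest on \<open>m + card K\<close> vertices.\<close>

lemma cut_count:
  assumes K_ne: "K \<noteq> {}" and k: "1 \<le> k" and mindeg: "\<And>x. x \<in> V \<Longrightarrow> k + 1 \<le> edge_degree G x"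
  obtains m where "m + k + 1 \<le> card (V - K)" "2 * k + 1 \<le> card (V - K)"
    "(\<Sum>x\<in>V - K. card (nbrs G x \<inter> K)) \<le> 3 * m + card K"
proof -
  have KV: "K \<subseteq> V" using K_subset by (auto simp: A_def)
  have finK: "finite K" using KV finite_V finite_subset by blast
  have finN: "finite (nbrs G v)" by (rule finite_nbrs) simp
  have "card {c \<in> nbrs G v. touches c} \<le> 1"
    using finN touching_unique by (intro card_le_Suc0_iff_eq[THEN iffD2, folded One_nat_def]) auto
  moreover have "card (nbrs G v) \<ge> k + 1" using mindeg[OF v_in_V] edge_degree_nbrs[of G v] by simp
  moreover have "card (nbrs G v - {c \<in> nbrs G v. touches c})
      = card (nbrs G v) - card {c \<in> nbrs G v. touches c}"
    using finN by (intro card_Diff_subset) auto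
  ultimately have "k \<le> card (nbrs G v - {c \<in> nbrs G v. touches c})" by linarith
  then obtain W where W: "W \<subseteq> nbrs G v - {c \<in> nbrs G v. touches c}" "card W = k" "finite W"
    by (rule obtain_subset_with_card_n)
  have WN: "c \<in> nbrs G v - K" "\<not> touches c" if "c \<in> W" for c
    using W(1) that by (auto simp: touches_def)
  define B where "B = (\<Union>c\<in>W. branch c)"
  define Y where "Y = V - K - {v} - B"
  have BV: "B \<subseteq> V - insert v K" using branch_subset WN(1) unfolding B_def by fast
  have finB: "finite B" and finY: "finite Y"
    using BV finite_V by (auto simp: Y_def intro: finite_subset)
  have finbr: "finite (branch c)" if "c \<in> W" for c
    using branch_subset[OF WN(1)[OF that]] finite_V by (meson finite_Diff finite_subset)
  have cB: "card B = (\<Sum>c\<in>W. card (branch c))"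
    unfolding B_def using W(3) finbr branches_disjoint WN(1) by (intro card_UN_disjoint) auto
  have VK: "V - K = insert v (B \<union> Y)" using BV v_in_V v_notin_K by (auto simp: Y_def)
  have vBY: "v \<notin> B \<union> Y" "B \<inter> Y = {}" using BV by (auto simp: Y_def)
  have q: "card (V - K) = 1 + card B + card Y"
    unfolding VK using vBY finB finY by (simp add: card_Un_disjoint)
  have self: "c \<in> branch c" for c by (simp add: branch_def)
  have br1: "1 \<le> card (branch c)" if "c \<in> W" for c
    using self finbr[OF that] by (metis One_nat_def Suc_leI card_gt_0_iff empty_iff)
  \<comment> \<open>Every neighbour of \<open>c\<close> is \<open>v\<close> or lies in its own
    branch or in \<open>Y\<close>: non-touching excludes \<open>K\<close>, and non-adjacency of
    branches excludes the rest of \<open>B\<close>.\<close>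
  have br2: "k + 1 \<le> card (branch c) + card Y" if c: "c \<in> W" for c
  proof -
    have "nbrs G c \<subseteq> {v} \<union> (branch c - {c}) \<union> Y"
    proof
      fix w assume w: "w \<in> nbrs G c"
      hence cw: "{c, w} \<in> G" "w \<in> V" "w \<noteq> c" using nbrs_subset[of G c] by (auto simp: nbrs_def)
      have "w \<notin> K" using WN(2)[OF c] self[of c] cw(1) unfolding touches_def by blast
      moreover have "w \<in> branch c" if wB: "w \<in> B"
      proof -
        obtain c' where "c' \<in> W" "w \<in> branch c'" using wB by (auto simp: B_def)
        thus ?thesis using branches_nonadjacent[OF WN(1)[OF c] WN(1)] self[of c] cw(1) by blast
      qed
      ultimately show "w \<in> {v} \<union> (branch c - {c}) \<union> Y" using cw by (auto simp: Y_def)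
    qed
    hence "card (nbrs G c) \<le> card ({v} \<union> (branch c - {c}) \<union> Y)"
      using finY finbr[OF c] by (intro card_mono) auto
    also have "\<dots> \<le> card ({v} \<union> (branch c - {c})) + card Y" by (rule card_Un_le)
    also have "card ({v} \<union> (branch c - {c})) \<le> 1 + card (branch c - {c})"
      using card_Un_le[of "{v}" "branch c - {c}"] by simp
    also have "card (branch c - {c}) = card (branch c) - 1" using self by (simp add: card_Diff_singleton)
    finally have "card (nbrs G c) \<le> 1 + (card (branch c) - 1) + card Y" by simp
    moreover have "c \<in> V" using WN(1)[OF c] nbrs_subset[of G v] by auto
    ultimately show ?thesis using mindeg[of c] edge_degree_nbrs[of G c] br1[OF c] by simp
  qed
  have B1: "k \<le> card B"
    using sum_mono[of W "\<lambda>_. 1" "\<lambda>c. card (branch c)"] br1 W(2) cB by simp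
  \<comment> \<open>Either \<open>Y\<close> supplies k vertices beyond the k roots of the branches,
    or \<open>Y\<close> is so small that \<open>br2\<close> gives each branch at least
    \<open>r + 2\<close> vertices, and two per branch already suffice.\<close>
  have BY: "2 * k \<le> card B + card Y"
  proof (cases "k \<le> card Y")
    case True
    thus ?thesis using B1 by simp
  next
    case False
    define r where "r = k - card Y - 1"
    have r: "k = card Y + r + 1" using False by (simp add: r_def)
    have "r + 2 \<le> card (branch c)" if "c \<in> W" for c using br2[OF that] r by linarith
    hence "(\<Sum>c\<in>W. r + 2) \<le> card B" unfolding cB by (rule sum_mono)
    hence "k * (r + 2) \<le> card B" using W(2) by simp
    moreover have "r * 1 \<le> k * r" using k by (metis mult.commute mult_le_mono2)
    ultimately show ?thesis using r by (simp add: algebra_simps)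
  qed
  have vK: "card (nbrs G v \<inter> K) \<le> 1"
    using finN touching_unique
    by (intro card_le_Suc0_iff_eq[THEN iffD2, folded One_nat_def]) (auto simp: touches_def)
  have BK: "nbrs G x \<inter> K = {}" if "x \<in> B" for x
    using that WN(2) unfolding B_def touches_def nbrs_def by blast
  \<comment> \<open>The \<open>+ 1\<close> on the left comes from the strictness of the forest
    bound; it pays for the possible edge from \<open>v\<close> to \<open>K\<close>.\<close>
  have YK: "(\<Sum>x\<in>Y. card (nbrs G x \<inter> K)) + 1 \<le> 3 * card Y + card K"
  proof -
    have "card (nbrs G x \<inter> K) \<le> 2 + card (nbrs (G - F) x \<inter> K)" if x: "x \<in> Y" for x
    proof (cases "x \<in> A")
      case True
      hence "nbrs G x \<inter> K = {}" using K_closed[of x] x by (auto simp: Y_def nbrs_def)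
      thus ?thesis by simp
    next
      case False
      have "card (nbrs G x \<inter> K) \<le> card (nbrs F x \<union> (nbrs (G - F) x \<inter> K))"
        using finite_nbrs[OF F_subset, of x] finK by (intro card_mono) (auto simp: nbrs_def)
      also have "\<dots> \<le> card (nbrs F x) + card (nbrs (G - F) x \<inter> K)" by (rule card_Un_le)
      also have "card (nbrs F x) \<le> 2"
        using F_degree_le_2[of x] False x edge_degree_nbrs[OF F_subset, of x] by (simp add: Y_def)
      finally show ?thesis by simp
    qed
    hence "(\<Sum>x\<in>Y. card (nbrs G x \<inter> K)) \<le> (\<Sum>x\<in>Y. 2 + card (nbrs (G - F) x \<inter> K))"
      by (rule sum_mono)
    moreover have "(\<Sum>x\<in>Y. card (nbrs (G - F) x \<inter> K)) < card Y + card K"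
    proof -
      define T where "T = {e \<in> G - F. e \<subseteq> Y \<union> K}"
      have dis: "Y \<inter> K = {}" by (auto simp: Y_def)
      have "(\<Sum>x\<in>Y. card (nbrs (G - F) x \<inter> K)) = card (SIGMA x:Y. nbrs (G - F) x \<inter> K)"
        using finY finK by (subst card_SigmaI) auto
      also have "\<dots> \<le> card T"
      proof (rule card_inj_on_le)
        show "inj_on (\<lambda>(x, z). {x, z}) (SIGMA x:Y. nbrs (G - F) x \<inter> K)"
          using dis by (auto simp: inj_on_def doubleton_eq_iff)
        show "(\<lambda>(x, z). {x, z}) ` (SIGMA x:Y. nbrs (G - F) x \<inter> K) \<subseteq> T"
          by (auto simp: T_def nbrs_def)
        show "finite T" using finite_G by (simp add: T_def)
      qed
      also have "\<dots> < card (Y \<union> K)"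
      proof (rule card_less_if_no_even_subgraph)
        fix C assume "C \<subseteq> T" "even_subgraph C"
        thus "C = {}" by (intro complement_forest) (auto simp: T_def)
      qed (use finY finK K_ne finite_G edge in \<open>auto simp: T_def\<close>)
      also have "\<dots> = card Y + card K" using dis finY finK by (simp add: card_Un_disjoint)
      finally show ?thesis .
    qed
    ultimately show ?thesis unfolding sum.distrib by simp
  qed
  have "(\<Sum>x\<in>V - K. card (nbrs G x \<inter> K))
      = card (nbrs G v \<inter> K) + (\<Sum>x\<in>B. card (nbrs G x \<inter> K)) + (\<Sum>x\<in>Y. card (nbrs G x \<inter> K))"
    unfolding VK using vBY finB finY by (simp add: sum.union_disjoint)
  moreover have "(\<Sum>x\<in>B. card (nbrs G x \<inter> K)) = 0" using BK by simp
  ultimately have "(\<Sum>x\<in>V - K. card (nbrs G x \<inter> K)) \<le> 3 * card Y + card K"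
    using vK YK by linarith
  thus ?thesis using that[of "card Y"] q B1 BY by simp
qed

end

end

section \<open>Counting non-edges across the cut\<close>

lemma cut_count_arith:
  fixes k p q :: int
  assumes "1 \<le> k" "2 * k + 1 \<le> q" "q \<le> p" "8 * k + 2 \<le> p + q"
  shows "6 * (q - 1 - k) + 2 * p + 3 * k * (p + q - 2 * k - 1) < 2 * (p * q)"
proof -
  define i where "i = p - q"
  have p: "p = q + i" and i: "i \<ge> 0" using assms(3) by (auto simp: i_def)
  have kk: "k \<le> k * k" using assms(1) by simp
  \<comment> \<open>The split is at half of the least order 8k + 2. Above it the binding constraint
    is \<open>q \<le> p\<close>, with slack \<open>i\<close>; below it, the lower bound on
    \<open>p + q\<close>, with slack \<open>h\<close>. At the extreme \<open>q = 2 * k + 1\<close>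
    the margin is k(p - 6), positive because p is at least 6k + 1.\<close>
  show ?thesis
  proof (cases "4 * k + 1 \<le> q")
    case True
    define t where "t = q - 1 - 4 * k"
    have q: "q = 4 * k + 1 + t" and t: "t \<ge> 0" using True by (auto simp: t_def)
    have "2 * (p * q) - (6 * (q - 1 - k) + 2 * p + 3 * k * (p + q - 2 * k - 1))
        = (13 * (k * k - k) + k * k) + t * (10 * k - 4) + 2 * t * t + i * (5 * k + 2 * t)"
      unfolding p q by (simp add: algebra_simps)
    moreover have "0 < 13 * (k * k - k) + k * k" using kk assms(1) by (intro add_nonneg_pos) auto
    moreover have "0 \<le> t * (10 * k - 4)" "0 \<le> 2 * t * t" "0 \<le> i * (5 * k + 2 * t)"
      using t i assms(1) by (auto intro!: mult_nonneg_nonneg)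
    ultimately show ?thesis by linarith
  next
    case False
    define j where "j = q - 1 - 2 * k"
    have q: "q = 2 * k + 1 + j" and j: "j \<ge> 0" "j \<le> 2 * k - 1" using False assms(2) by (auto simp: j_def)
    define h where "h = i - (4 * k - 2 * j)"
    have i': "i = 4 * k - 2 * j + h" and h: "h \<ge> 0" using assms(4) unfolding p q h_def by auto
    have "2 * (p * q) - (6 * (q - 1 - k) + 2 * p + 3 * k * (p + q - 2 * k - 1))
        = (5 * (k * k - k) + k * k) + j * (8 * k - 4 - 2 * j) + h * (k + 2 * j)"
      unfolding p q i' by (simp add: algebra_simps)
    moreover have "0 < 5 * (k * k - k) + k * k" using kk assms(1) by (intro add_nonneg_pos) auto
    moreover have "0 \<le> j * (8 * k - 4 - 2 * j)" "0 \<le> h * (k + 2 * j)"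
      using j h assms(1) by (auto intro!: mult_nonneg_nonneg)
    ultimately show ?thesis by linarith
  qed
qed

lemma sum_card_nbrs_swap:
  assumes "finite X" "finite Y"
  shows "(\<Sum>x\<in>X. card (nbrs S x \<inter> Y)) = (\<Sum>y\<in>Y. card (nbrs S y \<inter> X))"
proof -
  have *: "card (nbrs S x \<inter> Y) = (\<Sum>y\<in>Y. if {x, y} \<in> S then 1 else 0)" if "finite Y" for x Y
    using that by (simp add: sum.If_cases nbrs_def Int_commute)
  have "(\<Sum>x\<in>X. card (nbrs S x \<inter> Y)) = (\<Sum>y\<in>Y. \<Sum>x\<in>X. if {x, y} \<in> S then 1 else 0)"
    unfolding *[OF assms(2)] by (rule sum.swap)
  thus ?thesis unfolding *[OF assms(1)] by (simp add: insert_commute)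
qed

text \<open>Even if both sides of the cut were complete, the 2pq ordered pairs across it, less twice
  the few crossing edges, would have to fit into the allowance 3k(n - 2k - 1). The estimate
  \<open>cut_count_arith\<close> rules this out.\<close>

lemma (in uncovered_vertex) too_many_nonedges:
  assumes n: "card V = n" and k: "1 \<le> k" and nk: "8 * k + 2 \<le> n"
    and mindeg: "\<And>x. x \<in> V \<Longrightarrow> k + 1 \<le> edge_degree G x"
    and dense: "n * (n - 1) \<le> (\<Sum>x\<in>V. edge_degree G x) + 3 * k * (n - 2 * k - 1)"
  shows False
proof -
  define s where "s = (\<Sum>x\<in>V. edge_degree G x)"
  define m where "m = n - (8 * k + 2)"
  have nm: "n = 8 * k + 2 + m" using nk by (simp add: m_def)
  have "n * (n - 2) + 4 * (n - 1) + 6 * k * (n - 2 * k - 1) < 2 * (n * (n - 1))"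
  proof -
    have "k \<le> k * k" using k by simp
    moreover have "n - 2 = 8 * k + m" "n - 1 = 8 * k + 1 + m" "n - 2 * k - 1 = 6 * k + 1 + m"
      using nm by auto
    moreover have "6 * k < m * m + (k * (m * 10) + 28 * (k * k))"
      using k \<open>k \<le> k * k\<close> by linarith
    ultimately show ?thesis unfolding nm by (simp add: algebra_simps)
  qed
  hence "n * (n - 2) + 4 * (n - 1) < 2 * s" using dense unfolding s_def[symmetric] by linarith
  then obtain z where z: "z \<in> A" "n \<le> 2 * card (comp z)"
    using large_component[OF n] nk k unfolding s_def by auto
  define K where "K = comp z"
  have KA: "K \<subseteq> A" unfolding K_def by (rule comp_subset[OF z(1)])
  have conn: "A_adj\<^sup>*\<^sup>* x y" if "x \<in> K" "y \<in> K" for x y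
    using that rtranclp_symmetric[of A_adj z x] A_adj_sym unfolding K_def comp_def by auto
  have closed: "{x, y} \<notin> G" if "x \<in> A - K" "y \<in> K" for x y
  proof
    assume "{x, y} \<in> G"
    hence "A_adj y x" using that KA by (auto simp: A_adj_def insert_commute)
    moreover have "A_adj\<^sup>*\<^sup>* z y" "\<not> A_adj\<^sup>*\<^sup>* z x" using that by (auto simp: K_def comp_def)
    ultimately show False by (meson rtranclp.rtrancl_into_rtrancl)
  qed
  have KV: "K \<subseteq> V" using KA by (auto simp: A_def)
  have finK: "finite K" using KV finite_V finite_subset by blast
  have "K \<noteq> {}" by (auto simp: K_def comp_def)
  then obtain r where r: "r + k + 1 \<le> card (V - K)" "2 * k + 1 \<le> card (V - K)"
    "(\<Sum>x\<in>V - K. card (nbrs G x \<inter> K)) \<le> 3 * r + card K"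
    using cut_count[OF KA conn closed _ k mindeg] by metis
  define p where "p = card K"
  define q where "q = card (V - K)"
  have pq: "p + q = n"
    using card_mono[OF finite_V KV] by (simp add: p_def q_def card_Diff_subset[OF finK KV] n)
  have inside: "(\<Sum>x\<in>X. edge_degree G x) \<le> (\<Sum>x\<in>X. card (nbrs G x \<inter> (V - X))) + card X * (card X - 1)"
    if X: "X \<subseteq> V" for X
  proof -
    have finX: "finite X" using X finite_V finite_subset by blast
    have "(\<Sum>x\<in>X. edge_degree G x) \<le> (\<Sum>x\<in>X. card (nbrs G x \<inter> (V - X)) + (card X - 1))"
    proof (rule sum_mono)
      fix x assume x: "x \<in> X"
      have "card (nbrs G x) \<le> card ((nbrs G x \<inter> (V - X)) \<union> (X - {x}))"
        using nbrs_subset[of G x] finX finite_V by (intro card_mono) auto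
      also have "\<dots> \<le> card (nbrs G x \<inter> (V - X)) + card (X - {x})" by (rule card_Un_le)
      finally show "edge_degree G x \<le> card (nbrs G x \<inter> (V - X)) + (card X - 1)"
        using x edge_degree_nbrs[of G x] by (simp add: card_Diff_singleton)
    qed
    thus ?thesis by (simp add: sum.distrib)
  qed
  have "s = (\<Sum>x\<in>V - K. edge_degree G x) + (\<Sum>x\<in>K. edge_degree G x)"
    unfolding s_def by (rule sum.subset_diff[OF KV finite_V])
  moreover have "V - (V - K) = K" using KV by auto
  ultimately have "s \<le> 2 * (3 * r + p) + q * (q - 1) + p * (p - 1)"
    using inside[of K] inside[of "V - K"] KV r(3)
      sum_card_nbrs_swap[OF finK finite_Diff[OF finite_V, of K], of G]
    unfolding p_def q_def by simp
  hence "n * (n - 1) \<le> 2 * (3 * r + p) + q * (q - 1) + p * (p - 1) + 3 * k * (n - 2 * k - 1)"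
    using dense unfolding s_def[symmetric] by linarith
  hence "int (n * (n - 1)) \<le> int (2 * (3 * r + p) + q * (q - 1) + p * (p - 1) + 3 * k * (n - 2 * k - 1))"
    by (simp only: of_nat_le_iff)
  moreover have "q \<ge> 1" "p \<ge> 1" "n \<ge> 1" "n \<ge> 2 * k + 1" "q \<le> p"
    using r z(2) pq k nk unfolding p_def q_def K_def by auto
  ultimately have "(int p + int q) * (int p + int q - 1) \<le> 6 * int r + 2 * int p
     + int q * (int q - 1) + int p * (int p - 1) + 3 * int k * (int p + int q - 2 * int k - 1)"
    unfolding pq[symmetric] by (simp add: of_nat_diff add.commute[of 1] diff_diff_eq)
  hence "2 * (int p * int q) \<le> 6 * int r + 2 * int p + 3 * int k * (int p + int q - 2 * int k - 1)"
    by (simp add: algebra_simps)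
  also have "\<dots> \<le> 6 * (int q - 1 - int k) + 2 * int p + 3 * int k * (int p + int q - 2 * int k - 1)"
    using r(1) by (simp add: q_def)
  also have "\<dots> < 2 * (int p * int q)"
    by (rule cut_count_arith) (use k r(2) \<open>q \<le> p\<close> pq nk in \<open>auto simp: q_def\<close>)
  finally show False by simp
qed

lemma dense_graph_has_even_factor:
  assumes G: "simple_graph V E" and n: "card V = n" and k: "1 \<le> k" and nk: "8 * k + 2 \<le> n"
    and mindeg: "\<And>x. x \<in> V \<Longrightarrow> k + 1 \<le> degree V E x"
    and dense: "n * (n - 1) \<le> (\<Sum>x\<in>V. degree V E x) + 3 * k * (n - 2 * k - 1)"
  shows "has_even_factor V E"
proof -
  define ES where "ES = {{u, w} |u w. E u w}"
  have fin: "finite V" and sym: "\<And>u v. E u v \<Longrightarrow> E v u" and irr: "\<And>v. \<not> E v v"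
    and EV: "\<And>u v. E u v \<Longrightarrow> u \<in> V \<and> v \<in> V"
    using G unfolding simple_graph_def by blast+
  have ES_iff: "{u, w} \<in> ES \<longleftrightarrow> E u w" for u w
    using sym by (auto simp: ES_def doubleton_eq_iff)
  have edge: "e \<subseteq> V \<and> card e = 2" if "e \<in> ES" for e
    using that EV irr by (auto simp: ES_def card_2_iff) metis
  have finE: "finite ES" by (rule finite_subset[of _ "Pow V"]) (use edge fin in auto)
  have deg: "degree V (\<lambda>u w. {u, w} \<in> S) x = edge_degree S x" if "S \<subseteq> ES" for S x
  proof -
    have "nbrs S x = {w \<in> V. {x, w} \<in> S}" using that edge by (fastforce simp: nbrs_def)
    moreover have "edge_degree S x = card (nbrs S x)"
      by (rule edge_degree_eq_card_nbrs) (use that edge in blast)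
    ultimately show ?thesis by (simp add: degree_def)
  qed
  have degE: "degree V E x = edge_degree ES x" for x
    using deg[of ES x] by (simp add: ES_iff)
  define cov where "cov S = {x \<in> V. edge_degree S x > 0}" for S
  \<comment> \<open>A lexicographic order in one number: \<open>card S\<close> never exceeds
    \<open>card ES\<close>, so one more covered vertex outweighs any loss of edges.\<close>
  define f where "f S = card (cov S) * (card ES + 1) + card S" for S
  define \<F> where "\<F> = {S. S \<subseteq> ES \<and> even_subgraph S}"
  have "finite \<F>" by (rule finite_subset[of _ "Pow ES"]) (use finE in \<open>auto simp: \<F>_def\<close>)
  moreover have "{} \<in> \<F>" by (simp add: \<F>_def even_subgraph_def)
  ultimately obtain F where F: "F \<in> \<F>" and "f F = Max (f ` \<F>)"
    using Max_in[of "f ` \<F>"] by fastforce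
  hence fmax: "f S \<le> f F" if "S \<in> \<F>" for S using that \<open>finite \<F>\<close> by simp
  have FE: "F \<subseteq> ES" and Fev: "even_subgraph F" using F by (auto simp: \<F>_def)
  have finF: "finite F" using FE finE finite_subset by blast
  have fcov: "finite (cov S)" for S using fin by (simp add: cov_def)
  have sd: "symm_diff F C \<in> \<F>" if "C \<subseteq> ES" "even_subgraph C" for C
    using that F edge_degree_symm_diff_parity[OF finF, of C] finite_subset[OF that(1) finE]
    by (auto simp: \<F>_def even_subgraph_def symm_diff_def)
  show ?thesis
  proof (cases "\<exists>v\<in>V. edge_degree F v = 0")
    case False
    thus ?thesis unfolding has_even_factor_def
      by (intro exI[of _ "\<lambda>u w. {u, w} \<in> F"])
         (use FE Fev deg[OF FE] ES_iff in \<open>auto simp: even_subgraph_def insert_commute\<close>)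
  next
    case True
    then obtain v where v: "v \<in> V" "edge_degree F v = 0" by blast
    interpret uncovered_vertex V ES F v
    proof
      fix C assume C: "C \<subseteq> ES - F" "even_subgraph C"
      have finC: "finite C" using C(1) finE finite_subset by blast
      have eq: "symm_diff F C = F \<union> C" using C(1) by (auto simp: symm_diff_def)
      have "cov F \<subseteq> cov (F \<union> C)"
        unfolding cov_def using edge_degree_mono[of "F \<union> C" F] finF finC
        by (auto intro: less_le_trans)
      hence "card (cov F) \<le> card (cov (F \<union> C))" by (rule card_mono[OF fcov])
      hence "card (cov F) * (card ES + 1) \<le> card (cov (F \<union> C)) * (card ES + 1)" by (rule mult_le_mono1)
      moreover have "f (F \<union> C) \<le> f F" using fmax sd[of C] C eq by auto
      ultimately have "card (F \<union> C) \<le> card F" unfolding f_def by linarith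
      moreover have "card (F \<union> C) = card F + card C"
        using finF finC C(1) by (intro card_Un_disjoint) auto
      ultimately show "C = {}" using finC by simp
    next
      fix C assume C: "C \<subseteq> ES" "even_subgraph C" and vC: "edge_degree (symm_diff F C) v > 0"
      show "\<exists>x. edge_degree F x > 0 \<and> edge_degree (symm_diff F C) x = 0"
      proof (rule ccontr)
        assume none: "\<nexists>x. edge_degree F x > 0 \<and> edge_degree (symm_diff F C) x = 0"
        have "edge_degree (symm_diff F C) x \<noteq> 0" if "edge_degree F x > 0" for x
        proof
          assume "edge_degree (symm_diff F C) x = 0"
          hence "\<exists>x. edge_degree F x > 0 \<and> edge_degree (symm_diff F C) x = 0"
            using that by (intro exI conjI)
          thus False using none by (rule notE[rotated])
        qed
        hence "insert v (cov F) \<subseteq> cov (symm_diff F C)" using vC v unfolding cov_def by auto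
        hence "card (insert v (cov F)) \<le> card (cov (symm_diff F C))" by (rule card_mono[OF fcov])
        moreover have "v \<notin> cov F" using v by (simp add: cov_def)
        ultimately have "card (cov F) + 1 \<le> card (cov (symm_diff F C))" using fcov by simp
        hence "(card (cov F) + 1) * (card ES + 1) \<le> card (cov (symm_diff F C)) * (card ES + 1)"
          by (rule mult_le_mono1)
        moreover have "card F \<le> card ES" using finE FE by (rule card_mono)
        ultimately have "f F < f (symm_diff F C)" unfolding f_def by simp
        thus False using fmax[OF sd[OF C]] by simp
      qed
    qed (use fin edge FE Fev v in auto)
    have False
      by (rule too_many_nonedges[OF n k nk]) (use mindeg dense degE in auto)
    thus ?thesis ..
  qed
qed

theorem theorem1p2:
  fixes V :: "'a set" and E :: "'a \<Rightarrow> 'a \<Rightarrow> bool" and n \<delta> :: nat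
  assumes "simple_graph V E" and "connected_graph V E"
    and "card V = n" and "even n"
    and "\<delta> \<ge> 2" and "min_degree V E = \<delta>"
    and "n \<ge> 8 * \<delta> - 7" and "real n \<ge> real (\<delta>^2) / 3 + 3"
    and "dist_spectral_radius V E \<le> dist_spectral_radius (ext_vertices n) (ext_edge n \<delta>)"
    and "\<not> graph_iso V E (ext_vertices n) (ext_edge n \<delta>)"
  shows "has_even_factor V E"
proof -
  define k where "k = \<delta> - 1"
  have k: "1 \<le> k" "\<delta> = k + 1" using assms(5) by (auto simp: k_def)
  \<comment> \<open>Here 8\<delta> - 7 equals 8k + 1, which is odd, so even order gains one more
    vertex.\<close>
  have "8 * k + 1 \<le> n" "odd (8 * k + 1)" using assms(7) k by auto
  hence nk: "8 * k + 2 \<le> n" using assms(4) by (cases "n = 8 * k + 1") auto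
  have fin: "finite V" using assms(1) by (simp add: simple_graph_def)
  have mindeg: "k + 1 \<le> degree V E x" if "x \<in> V" for x
    using assms(6) k that fin unfolding min_degree_def by (metis Min_le finite_imageI imageI)
  have deg_le: "degree V E x \<le> n - 1" if "x \<in> V" for x
  proof -
    have "{w \<in> V. E x w} \<subseteq> V - {x}" using assms(1) by (auto simp: simple_graph_def)
    hence "degree V E x \<le> card (V - {x})" unfolding degree_def using fin by (intro card_mono) auto
    thus ?thesis using that fin assms(3) by simp
  qed
  have "real n * real (n - 1) + real (\<Sum>v\<in>V. n - 1 - degree V E v) \<le> real n * dist_spectral_radius V E"
    by (rule dist_spectral_radius_ge_average) (rule assms)+
  also have "\<dots> \<le> real n * dist_spectral_radius (ext_vertices n) (ext_edge n \<delta>)"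
    using assms(9) by (rule mult_left_mono) simp
  also have "\<dots> \<le> real n * (real n - 1) + 3 * real k * (real n - 2 * real k - 1)"
    by (rule dist_spectral_radius_ext_le[OF k(1) nk k(2)])
  also have "\<dots> = real n * real (n - 1) + real (3 * k * (n - 2 * k - 1))"
    using nk by (simp add: of_nat_diff)
  \<comment> \<open>The common term n(n - 1) cancels, leaving a bound on twice the number of
    non-edges.\<close>
  finally have "(\<Sum>v\<in>V. n - 1 - degree V E v) \<le> 3 * k * (n - 2 * k - 1)"
    by (simp only: add_le_cancel_left of_nat_le_iff)
  moreover have "(\<Sum>v\<in>V. n - 1) = (\<Sum>v\<in>V. n - 1 - degree V E v) + (\<Sum>v\<in>V. degree V E v)"
    unfolding sum.distrib[symmetric] using deg_le by (intro sum.cong refl) (simp del: diff_diff_left One_nat_def)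
  ultimately have "n * (n - 1) \<le> (\<Sum>x\<in>V. degree V E x) + 3 * k * (n - 2 * k - 1)"
    using assms(3) by simp
  thus ?thesis using dense_graph_has_even_factor[OF assms(1,3) k(1) nk mindeg] by blast
qed

end
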